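(* Let $\Gamma$ be a discrete group and let $\mathcal{E}=(E_k)_{k\in\mathbb{N}}$ be an asymptotic Banach $\Gamma$-module. For every fixed $n\in\mathbb{N}$, the following assertions are equivalent: (1) $\bar{H}^n_a(\Gamma;\mathcal{E})=0$. (2) $H^n_a(\Gamma;\mathcal{E})=0$. (3) $H^n_a(\Gamma;\mathcal{E})=0$ and $H^{n+1}_a(\Gamma;\mathcal{E})$ is Hausdorff.
   Context: $\mathbb{N}$ is the set of positive integers, and $\mathcal{U}$ is a fixed non-principal ultrafilter on $\mathbb{N}$; limits $\lim_{\mathcal{U}}$ along $\mathcal{U}$ are taken in the variable $k$. Ultraproducts: for a sequence $(V_k)_{k\in\mathbb{N}}$ of Banach spaces, $\prod_{\mathcal{U}}V_k$ is the Banach space obtained as the quotient of the space of sequences $(x_k)\in\prod_k V_k$ with $\sup_k\|x_k\|<\infty$ by the subspace of those with $\lim_{\mathcal{U}}\|x_k\|=0$, with norm $\|[x_k]\|_{\mathcal{U}}=\lim_{\mathcal{U}}\|x_k\|$. A sequence of bounded linear maps $f_k:V_k\to W_k$ with $\sup_k\|f_k\|<\infty$ induces a bounded linear map $f_{\mathcal{U}}:\prod_{\mathcal{U}}V_k\to\prod_{\mathcal{U}}W_k$, $[x_k]\mapsto[f_k(x_k)]$. An asymptotic Banach $\Gamma$-module is a sequence $\mathcal{E}=(E_k)_{k\in\mathbb{N}}$ of Banach spaces together with group morphisms $\pi_k:\Gamma\to\mathrm{Isom}(E_k)$ into the groups of linear isometries of $E_k$; write $\gamma\cdot x=\pi_k(\gamma)x$.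 For $n\ge 0$ let $\ell^\infty(\Gamma^n,E_k)$ be the Banach space of bounded maps $\Gamma^n\to E_k$ with the supremum norm (so it is $E_k$ for $n=0$). For $n\geq 1$ the codifferential $d^n_k:\ell^\infty(\Gamma^{n-1},E_k)\to\ell^\infty(\Gamma^{n},E_k)$ is $$d^n_kf(\gamma_1,\dots,\gamma_n)=\gamma_1\cdot f(\gamma_2,\dots,\gamma_n)+\sum_{i=1}^{n-1}(-1)^if(\gamma_1,\dots,\gamma_i\gamma_{i+1},\dots,\gamma_n)+(-1)^nf(\gamma_1,\dots,\gamma_{n-1}).$$ Let $C^n_a(\Gamma;\mathcal{E})=\prod_{\mathcal{U}}\ell^\infty(\Gamma^n,E_k)$ and let $d^n_{\mathcal{U}}:C^{n-1}_a(\Gamma;\mathcal{E})\to C^n_a(\Gamma;\mathcal{E})$ be the map induced by $(d^n_k)_k$. The asymptotic cohomology is $H^n_a(\Gamma;\mathcal{E})=\ker d^{n+1}_{\mathcal{U}}/\operatorname{im}d^n_{\mathcal{U}}$, and the reduced asymptotic cohomology is $\bar{H}^n_a(\Gamma;\mathcal{E})=\ker d^{n+1}_{\mathcal{U}}/\overline{\operatorname{im}d^n_{\mathcal{U}}}$ (norm closure). $H^n_a(\Gamma;\mathcal{E})$ is called Hausdorff if its quotient topology is Hausdorff. *)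

theory Defs
  imports "HOL-Analysis.Analysis" "HOL-Algebra.Module" "HOL-Algebra.AbelCoset"
    "HOL-Algebra.Bij" "HOL-Algebra.Elementary_Groups"
begin

section \<open>Ultrafilters and quotient topologies\<close>

definition nonprincipal_ultrafilter :: "'i filter \<Rightarrow> bool" where
  "nonprincipal_ultrafilter \<U> \<longleftrightarrow>
     \<U> \<noteq> bot \<and>
     (\<forall>P. eventually P \<U> \<or> eventually (\<lambda>i. \<not> P i) \<U>) \<and>
     (\<forall>j. \<not> eventually (\<lambda>i. i = j) \<U>)"

definition quotient_topology :: "'a topology \<Rightarrow> ('a \<Rightarrow> 'b) \<Rightarrow> 'b topology" where
  "quotient_topology X q =
     topology (\<lambda>V. V \<subseteq> q ` topspace X \<and> openin X {x \<in> topspace X. q x \<in> V})"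

lemma istopology_quotient:
  "istopology (\<lambda>V. V \<subseteq> q ` topspace X \<and> openin X {x \<in> topspace X. q x \<in> V})"
proof -
  have Int: "openin X {x \<in> topspace X. q x \<in> S \<inter> T}"
    if "openin X {x \<in> topspace X. q x \<in> S}" "openin X {x \<in> topspace X. q x \<in> T}" for S T
    using openin_Int [OF that] by (rule back_subst [where P = "openin X"]) auto
  have Union: "openin X {x \<in> topspace X. q x \<in> \<Union>\<K>}"
    if "\<forall>K\<in>\<K>. openin X {x \<in> topspace X. q x \<in> K}" for \<K>
  proof -
    have "openin X (\<Union>K\<in>\<K>. {x \<in> topspace X. q x \<in> K})"
      using that by blast
    then show ?thesis
      by (rule back_subst [where P = "openin X"]) auto
  qed
  show ?thesis
    unfolding istopology_def by (intro conjI allI impI Int Union) blast+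
qed

lemma openin_quotient_topology:
  "openin (quotient_topology X q) V \<longleftrightarrow>
     V \<subseteq> q ` topspace X \<and> openin X {x \<in> topspace X. q x \<in> V}"
  unfolding quotient_topology_def by (simp add: istopology_quotient topology_inverse')

lemma topspace_quotient_topology: "topspace (quotient_topology X q) = q ` topspace X"
proof
  show "topspace (quotient_topology X q) \<subseteq> q ` topspace X"
    using openin_quotient_topology [of X q] openin_topspace by blast
  have "{x \<in> topspace X. q x \<in> q ` topspace X} = topspace X"
    by auto
  then have "openin (quotient_topology X q) (q ` topspace X)"
    by (simp add: openin_quotient_topology)
  then show "q ` topspace X \<subseteq> topspace (quotient_topology X q)"
    by (rule openin_subset)
qed

lemma quotient_map_quotient_topology: "quotient_map X (quotient_topology X q) q"
  unfolding quotient_map_def topspace_quotient_topology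
  by (auto simp: openin_quotient_topology)


section \<open>Normed and Banach spaces on explicit carriers\<close>

text \<open>
  Sequences of Banach spaces and their ultraproducts are not indexed by types, so vector spaces are
  modules over the field of real numbers in the sense of HOL-Algebra, extended by a norm.
  The fields \<open>mult\<close> and \<open>one\<close>, which the record of modules inherits from rings, carry no meaning;
  they are left undefined in the constructions below.
\<close>

record 'a normed_module = "(real, 'a) module" +
  vnorm :: "'a \<Rightarrow> real"

definition real_scalars :: "real ring" where
  "real_scalars = \<lparr>carrier = UNIV, mult = (*), one = 1, zero = 0, add = (+)\<rparr>"

definition normed_space :: "'a normed_module \<Rightarrow> bool" where
  "normed_space V \<longleftrightarrow>
     Module.module real_scalars V \<and>
     (\<forall>x\<in>carrier V. vnorm V x = 0 \<longleftrightarrow> x = \<zero>\<^bsub>V\<^esub>) \<and>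
     (\<forall>x\<in>carrier V. \<forall>y\<in>carrier V. vnorm V (x \<oplus>\<^bsub>V\<^esub> y) \<le> vnorm V x + vnorm V y) \<and>
     (\<forall>c. \<forall>x\<in>carrier V. vnorm V (c \<odot>\<^bsub>V\<^esub> x) = \<bar>c\<bar> * vnorm V x)"

text \<open>
  The locale \<open>Metric_space\<close> asks for a distance that is symmetric and nonnegative on the whole type,
  whence the default value outside the carrier.
\<close>

definition vdist :: "'a normed_module \<Rightarrow> 'a \<Rightarrow> 'a \<Rightarrow> real" where
  "vdist V x y = (if x \<in> carrier V \<and> y \<in> carrier V then vnorm V (x \<ominus>\<^bsub>V\<^esub> y) else 0)"

definition norm_topology :: "'a normed_module \<Rightarrow> 'a topology" where
  "norm_topology V = Metric_space.mtopology (carrier V) (vdist V)"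

definition banach_space :: "'a normed_module \<Rightarrow> bool" where
  "banach_space V \<longleftrightarrow>
     normed_space V \<and> Metric_space.mcomplete (carrier V) (vdist V)"

definition linear_isometries :: "'a normed_module \<Rightarrow> ('a \<Rightarrow> 'a) set" where
  "linear_isometries V =
     {T \<in> Bij (carrier V).
        (\<forall>x\<in>carrier V. \<forall>y\<in>carrier V. T (x \<oplus>\<^bsub>V\<^esub> y) = T x \<oplus>\<^bsub>V\<^esub> T y) \<and>
        (\<forall>c. \<forall>x\<in>carrier V. T (c \<odot>\<^bsub>V\<^esub> x) = c \<odot>\<^bsub>V\<^esub> T x) \<and>
        (\<forall>x\<in>carrier V. vnorm V (T x) = vnorm V x)}"

definition Isom :: "'a normed_module \<Rightarrow> ('a \<Rightarrow> 'a) monoid" where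
  "Isom V = (BijGroup (carrier V))\<lparr>carrier := linear_isometries V\<rparr>"


section \<open>Spaces of bounded maps\<close>

definition linfty :: "'s set \<Rightarrow> 'a normed_module \<Rightarrow> ('s \<Rightarrow> 'a) normed_module" where
  "linfty S V =
     \<lparr>carrier = {f \<in> S \<rightarrow>\<^sub>E carrier V. bdd_above ((\<lambda>s. vnorm V (f s)) ` S)},
      mult = undefined,
      one = undefined,
      zero = (\<lambda>s\<in>S. \<zero>\<^bsub>V\<^esub>),
      add = (\<lambda>f g. \<lambda>s\<in>S. f s \<oplus>\<^bsub>V\<^esub> g s),
      smult = (\<lambda>c f. \<lambda>s\<in>S. c \<odot>\<^bsub>V\<^esub> f s),
      vnorm = (\<lambda>f. SUP s\<in>S. vnorm V (f s))\<rparr>"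


section \<open>Ultraproducts\<close>

definition bounded_sequences :: "(nat \<Rightarrow> 'a normed_module) \<Rightarrow> (real, nat \<Rightarrow> 'a) module" where
  "bounded_sequences V =
     \<lparr>carrier = {x. (\<forall>k. x k \<in> carrier (V k)) \<and> bdd_above (range (\<lambda>k. vnorm (V k) (x k)))},
      mult = undefined,
      one = undefined,
      zero = (\<lambda>k. \<zero>\<^bsub>V k\<^esub>),
      add = (\<lambda>x y k. x k \<oplus>\<^bsub>V k\<^esub> y k),
      smult = (\<lambda>c x k. c \<odot>\<^bsub>V k\<^esub> x k)\<rparr>"

definition null_sequences :: "nat filter \<Rightarrow> (nat \<Rightarrow> 'a normed_module) \<Rightarrow> (nat \<Rightarrow> 'a) set" where
  "null_sequences \<U> V =
     {x \<in> carrier (bounded_sequences V). ((\<lambda>k. vnorm (V k) (x k)) \<longlongrightarrow> 0) \<U>}"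

definition uclass ::
  "nat filter \<Rightarrow> (nat \<Rightarrow> 'a normed_module) \<Rightarrow> (nat \<Rightarrow> 'a) \<Rightarrow> (nat \<Rightarrow> 'a) set" where
  "uclass \<U> V x = null_sequences \<U> V +>\<^bsub>bounded_sequences V\<^esub> x"

definition ultraproduct ::
  "nat filter \<Rightarrow> (nat \<Rightarrow> 'a normed_module) \<Rightarrow> (nat \<Rightarrow> 'a) set normed_module" where
  "ultraproduct \<U> V =
     \<lparr>carrier = a_rcosets\<^bsub>bounded_sequences V\<^esub> (null_sequences \<U> V),
      mult = undefined,
      one = undefined,
      zero = null_sequences \<U> V,
      add = (\<lambda>X Y. X <+>\<^bsub>bounded_sequences V\<^esub> Y),
      smult = (\<lambda>c X. \<Union>x\<in>X. uclass \<U> V (c \<odot>\<^bsub>bounded_sequences V\<^esub> x)),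
      vnorm = (\<lambda>X. Lim \<U> (\<lambda>k. vnorm (V k) ((SOME x. x \<in> X) k)))\<rparr>"

text \<open>
  The map induced by maps \<open>f k\<close> from \<open>V k\<close> to \<open>W k\<close>. For linear maps with uniformly bounded
  operator norms all members of the union are equal, so that it sends the class
  of \<open>x\<close> to the class of \<open>\<lambda>k. f k (x k)\<close>.
\<close>

definition ultra_map ::
  "nat filter \<Rightarrow> (nat \<Rightarrow> 'b normed_module) \<Rightarrow> (nat \<Rightarrow> 'a \<Rightarrow> 'b) \<Rightarrow>
    (nat \<Rightarrow> 'a) set \<Rightarrow> (nat \<Rightarrow> 'b) set" where
  "ultra_map \<U> W f X = (\<Union>x\<in>X. uclass \<U> W (\<lambda>k. f k (x k)))"


section \<open>Asymptotic cohomology\<close>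

definition asymptotic_banach_module ::
  "('g, 'm) monoid_scheme \<Rightarrow> (nat \<Rightarrow> 'e normed_module) \<Rightarrow> (nat \<Rightarrow> 'g \<Rightarrow> 'e \<Rightarrow> 'e) \<Rightarrow> bool" where
  "asymptotic_banach_module \<Gamma> E \<pi> \<longleftrightarrow>
     (\<forall>k. banach_space (E k) \<and> \<pi> k \<in> hom \<Gamma> (Isom (E k)))"

definition tuples :: "('g, 'm) monoid_scheme \<Rightarrow> nat \<Rightarrow> 'g list set" where
  "tuples \<Gamma> n = {\<gamma>. length \<gamma> = n \<and> set \<gamma> \<subseteq> carrier \<Gamma>}"

text \<open>
  For \<open>1 \<le> i < n\<close>, \<open>merge_at \<Gamma> i [\<gamma>\<^sub>1, \<dots>, \<gamma>\<^sub>n]\<close> is \<open>[\<gamma>\<^sub>1, \<dots>, \<gamma>\<^sub>i \<gamma>\<^sub>i\<^sub>+\<^sub>1, \<dots>, \<gamma>\<^sub>n]\<close>;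
  list positions are counted from 0.
\<close>

definition merge_at :: "('g, 'm) monoid_scheme \<Rightarrow> nat \<Rightarrow> 'g list \<Rightarrow> 'g list" where
  "merge_at \<Gamma> i \<gamma> =
     take (i - 1) \<gamma> @ [\<gamma> ! (i - 1) \<otimes>\<^bsub>\<Gamma>\<^esub> \<gamma> ! i] @ drop (i + 1) \<gamma>"

text \<open>
  The codifferential from maps on \<open>(n - 1)\<close>-tuples to maps on \<open>n\<close>-tuples, meaningful only for
  \<open>n \<ge> 1\<close>. The same restriction applies to \<open>asym_d\<close>, and to the coboundaries and
  cohomology groups defined from it.
\<close>

definition codiff ::
  "('g, 'm) monoid_scheme \<Rightarrow> 'e normed_module \<Rightarrow> ('g \<Rightarrow> 'e \<Rightarrow> 'e) \<Rightarrow> nat \<Rightarrow>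
    ('g list \<Rightarrow> 'e) \<Rightarrow> ('g list \<Rightarrow> 'e)" where
  "codiff \<Gamma> V \<rho> n f =
     (\<lambda>\<gamma>\<in>tuples \<Gamma> n.
        \<rho> (hd \<gamma>) (f (tl \<gamma>))
        \<oplus>\<^bsub>V\<^esub> (\<Oplus>\<^bsub>V\<^esub>i\<in>{1..n-1}. (-1) ^ i \<odot>\<^bsub>V\<^esub> f (merge_at \<Gamma> i \<gamma>))
        \<oplus>\<^bsub>V\<^esub> (-1) ^ n \<odot>\<^bsub>V\<^esub> f (butlast \<gamma>))"

definition asym_cochains ::
  "nat filter \<Rightarrow> ('g, 'm) monoid_scheme \<Rightarrow> (nat \<Rightarrow> 'e normed_module) \<Rightarrow> nat \<Rightarrow>
    (nat \<Rightarrow> 'g list \<Rightarrow> 'e) set normed_module" where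
  "asym_cochains \<U> \<Gamma> E n = ultraproduct \<U> (\<lambda>k. linfty (tuples \<Gamma> n) (E k))"

definition asym_d ::
  "nat filter \<Rightarrow> ('g, 'm) monoid_scheme \<Rightarrow> (nat \<Rightarrow> 'e normed_module) \<Rightarrow> (nat \<Rightarrow> 'g \<Rightarrow> 'e \<Rightarrow> 'e) \<Rightarrow>
    nat \<Rightarrow> (nat \<Rightarrow> 'g list \<Rightarrow> 'e) set \<Rightarrow> (nat \<Rightarrow> 'g list \<Rightarrow> 'e) set" where
  "asym_d \<U> \<Gamma> E \<pi> n =
     ultra_map \<U> (\<lambda>k. linfty (tuples \<Gamma> n) (E k)) (\<lambda>k. codiff \<Gamma> (E k) (\<pi> k) n)"

definition asym_cocycles ::
  "nat filter \<Rightarrow> ('g, 'm) monoid_scheme \<Rightarrow> (nat \<Rightarrow> 'e normed_module) \<Rightarrow> (nat \<Rightarrow> 'g \<Rightarrow> 'e \<Rightarrow> 'e) \<Rightarrow>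
    nat \<Rightarrow> (nat \<Rightarrow> 'g list \<Rightarrow> 'e) set set" where
  "asym_cocycles \<U> \<Gamma> E \<pi> n =
     a_kernel (asym_cochains \<U> \<Gamma> E n) (asym_cochains \<U> \<Gamma> E (n + 1)) (asym_d \<U> \<Gamma> E \<pi> (n + 1))"

definition asym_coboundaries ::
  "nat filter \<Rightarrow> ('g, 'm) monoid_scheme \<Rightarrow> (nat \<Rightarrow> 'e normed_module) \<Rightarrow> (nat \<Rightarrow> 'g \<Rightarrow> 'e \<Rightarrow> 'e) \<Rightarrow>
    nat \<Rightarrow> (nat \<Rightarrow> 'g list \<Rightarrow> 'e) set set" where
  "asym_coboundaries \<U> \<Gamma> E \<pi> n =
     asym_d \<U> \<Gamma> E \<pi> n ` carrier (asym_cochains \<U> \<Gamma> E (n - 1))"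

definition asym_cohomology ::
  "nat filter \<Rightarrow> ('g, 'm) monoid_scheme \<Rightarrow> (nat \<Rightarrow> 'e normed_module) \<Rightarrow> (nat \<Rightarrow> 'g \<Rightarrow> 'e \<Rightarrow> 'e) \<Rightarrow>
    nat \<Rightarrow> (nat \<Rightarrow> 'g list \<Rightarrow> 'e) set set monoid" where
  "asym_cohomology \<U> \<Gamma> E \<pi> n =
     (asym_cochains \<U> \<Gamma> E n)\<lparr>carrier := asym_cocycles \<U> \<Gamma> E \<pi> n\<rparr>
       A_Mod asym_coboundaries \<U> \<Gamma> E \<pi> n"

definition reduced_asym_cohomology ::
  "nat filter \<Rightarrow> ('g, 'm) monoid_scheme \<Rightarrow> (nat \<Rightarrow> 'e normed_module) \<Rightarrow> (nat \<Rightarrow> 'g \<Rightarrow> 'e \<Rightarrow> 'e) \<Rightarrow>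
    nat \<Rightarrow> (nat \<Rightarrow> 'g list \<Rightarrow> 'e) set set monoid" where
  "reduced_asym_cohomology \<U> \<Gamma> E \<pi> n =
     (asym_cochains \<U> \<Gamma> E n)\<lparr>carrier := asym_cocycles \<U> \<Gamma> E \<pi> n\<rparr>
       A_Mod (norm_topology (asym_cochains \<U> \<Gamma> E n) closure_of asym_coboundaries \<U> \<Gamma> E \<pi> n)"

definition asym_cohomology_topology ::
  "nat filter \<Rightarrow> ('g, 'm) monoid_scheme \<Rightarrow> (nat \<Rightarrow> 'e normed_module) \<Rightarrow> (nat \<Rightarrow> 'g \<Rightarrow> 'e \<Rightarrow> 'e) \<Rightarrow>
    nat \<Rightarrow> (nat \<Rightarrow> 'g list \<Rightarrow> 'e) set set topology" where
  "asym_cohomology_topology \<U> \<Gamma> E \<pi> n =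
     quotient_topology
       (subtopology (norm_topology (asym_cochains \<U> \<Gamma> E n)) (asym_cocycles \<U> \<Gamma> E \<pi> n))
       (\<lambda>z. asym_coboundaries \<U> \<Gamma> E \<pi> n +>\<^bsub>asym_cochains \<U> \<Gamma> E n\<^esub> z)"

end

theory Submission
  imports Defs
begin

text \<open>
  Write \<open>A\<^sub>k\<close>, \<open>B\<^sub>k\<close>, \<open>C\<^sub>k\<close> for three consecutive cochain spaces at level \<open>k\<close>, with differentials
  \<open>d\<close> and \<open>d'\<close>. If the coboundaries are dense in the cocycles of the ultraproduct, a diagonal argument
  along the ultrafilter yields uniform constants \<open>K\<close>, \<open>\<delta>\<close> such that for almost all \<open>k\<close> every \<open>z\<close>
  in the unit ball of \<open>B\<^sub>k\<close> with \<open>\<parallel>d' z\<parallel> \<le> \<delta>\<close> is within \<open>1/2\<close> of some \<open>d a\<close> with \<open>\<parallel>a\<parallel> \<le> K\<close>.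
  Iterating and rescaling at a fixed level \<open>k\<close>, one gets approximate primitives with arbitrarily small
  error and bounded norm, and preimages \<open>b'\<close> under \<open>d'\<close> with \<open>\<parallel>b'\<parallel>\<close> controlled by \<open>\<parallel>d' b'\<parallel>\<close>.
  A second diagonal argument turns these approximations into exact solutions in the ultraproduct: the
  first shows that every cocycle is a coboundary, the second that the image of \<open>d'\<close> is closed.
\<close>

section \<open>Normed groups and their quotients\<close>

text \<open>Two obstacles shape the argument. A class in the ultraproduct is a cocycle as soon as
  \<open>d' z\<close> tends to 0 along the ultrafilter, so the single levels carry approximate
  cocycles only; the tolerance \<delta> is there for them. And density approximates each cocycle
  separately, by images of cochains of uncontrolled size; it takes an argument by contradiction to
  make that size uniform. Since \<open>d' (d a)\<close> is exactly zero at each level, replacing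
  \<open>z\<close> by \<open>z - d a\<close> leaves \<open>d' z\<close> unchanged. One correction
  halves the bound on \<open>z\<close>, and corrections can be repeated until that bound has come
  down to about \<parallel>d' z\<parallel> / \<delta>. This single process is read in two ways: if
  \<open>d' z\<close> is tiny, the sum of the corrections is a primitive of \<open>z\<close> up to a
  tiny error; if \<open>z\<close> is huge, what remains of \<open>z\<close> is a bounded vector with
  the same image under \<open>d'\<close>. The iterations stay finite, because the diagonal argument
  takes over the role of the limit: it suffices to produce approximate solutions at almost every
  level with a bound that does not depend on the error.\<close>

locale normed_group = abelian_group V for V :: "'a normed_module" (structure) +
  assumes norm_eq_0: "x \<in> carrier V \<Longrightarrow> vnorm V x = 0 \<longleftrightarrow> x = \<zero>"
    and norm_triangle: "\<lbrakk>x \<in> carrier V; y \<in> carrier V\<rbrakk> \<Longrightarrow> vnorm V (x \<oplus> y) \<le> vnorm V x + vnorm V y"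
    and norm_minus: "x \<in> carrier V \<Longrightarrow> vnorm V (\<ominus> x) = vnorm V x"
begin

lemma norm_zero [simp]: "vnorm V \<zero> = 0"
  by (simp add: norm_eq_0)

lemma norm_nonneg [simp]: "x \<in> carrier V \<Longrightarrow> 0 \<le> vnorm V x"
  using norm_triangle[of x "\<ominus> x"] by (simp add: norm_minus r_neg)

lemma diff_zero [simp]: "x \<in> carrier V \<Longrightarrow> x \<ominus> \<zero> = x"
  using minus_equality[of \<zero> \<zero>] by (simp add: minus_eq)

lemma add_neg_cancel: "\<lbrakk>y \<in> carrier V; z \<in> carrier V\<rbrakk> \<Longrightarrow> z \<oplus> (y \<oplus> \<ominus> z) = y"
  by (metis a_lcomm a_inv_closed r_neg r_zero)

lemma diff_add_diff: "\<lbrakk>x \<in> carrier V; y \<in> carrier V; z \<in> carrier V\<rbrakk> \<Longrightarrow> (x \<ominus> y) \<oplus> (y \<ominus> z) = x \<ominus> z"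
  by (simp add: minus_eq a_ac r_neg2 r_neg1)

lemma diff_eq_0: "\<lbrakk>x \<in> carrier V; y \<in> carrier V\<rbrakk> \<Longrightarrow> x \<ominus> y = \<zero> \<longleftrightarrow> x = y"
  by (metis add.inv_closed minus_equality minus_minus minus_eq r_neg)

lemma minus_diff: "\<lbrakk>x \<in> carrier V; y \<in> carrier V\<rbrakk> \<Longrightarrow> \<ominus> (x \<ominus> y) = y \<ominus> x"
  by (simp add: minus_eq minus_add a_ac)

lemma add_diff_add:
  "\<lbrakk>x \<in> carrier V; y \<in> carrier V; x' \<in> carrier V; y' \<in> carrier V\<rbrakk> \<Longrightarrow>
    (x \<oplus> y) \<ominus> (x' \<oplus> y') = (x \<ominus> x') \<oplus> (y \<ominus> y')"
  by (simp add: minus_eq minus_add a_ac)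

lemma norm_diff_commute: "\<lbrakk>x \<in> carrier V; y \<in> carrier V\<rbrakk> \<Longrightarrow> vnorm V (x \<ominus> y) = vnorm V (y \<ominus> x)"
  by (metis minus_closed minus_diff norm_minus)

lemma norm_diff_triangle:
  "\<lbrakk>x \<in> carrier V; y \<in> carrier V; z \<in> carrier V\<rbrakk> \<Longrightarrow>
    vnorm V (x \<ominus> z) \<le> vnorm V (x \<ominus> y) + vnorm V (y \<ominus> z)"
  by (metis minus_closed norm_triangle diff_add_diff)

lemma norm_diff_le: "\<lbrakk>x \<in> carrier V; y \<in> carrier V\<rbrakk> \<Longrightarrow> vnorm V (x \<ominus> y) \<le> vnorm V x + vnorm V y"
  using norm_triangle[of x "\<ominus> y"] by (simp add: minus_eq norm_minus)

lemma norm_le_add_diff: "\<lbrakk>x \<in> carrier V; y \<in> carrier V\<rbrakk> \<Longrightarrow> vnorm V x \<le> vnorm V y + vnorm V (x \<ominus> y)"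
  using norm_triangle[of y "x \<ominus> y"] by (simp add: minus_eq a_ac r_neg1 r_neg2 r_neg)

lemma Metric_space: "Metric_space (carrier V) (vdist V)"
proof
  fix x y show "0 \<le> vdist V x y" by (simp add: vdist_def)
  show "vdist V x y = vdist V y x" by (simp add: vdist_def norm_diff_commute)
next
  fix x y assume "x \<in> carrier V" "y \<in> carrier V"
  then show "vdist V x y = 0 \<longleftrightarrow> x = y" by (simp add: vdist_def norm_eq_0 diff_eq_0)
next
  fix x y z assume "x \<in> carrier V" "y \<in> carrier V" "z \<in> carrier V"
  then show "vdist V x z \<le> vdist V x y + vdist V y z"
    by (simp add: vdist_def norm_diff_triangle)
qed

sublocale metric: Metric_space "carrier V" "vdist V"
  by (rule Metric_space)

lemma in_ball: "y \<in> metric.mball x r \<longleftrightarrow> x \<in> carrier V \<and> y \<in> carrier V \<and> vnorm V (x \<ominus> y) < r"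
  by (auto simp: vdist_def)

lemma closure_of_norm_topology:
  "norm_topology V closure_of S =
    {x \<in> carrier V. \<forall>e>0. \<exists>y\<in>S. y \<in> carrier V \<and> vnorm V (y \<ominus> x) < e}"
  unfolding norm_topology_def metric.metric_closure_of in_ball
  using norm_diff_commute by fastforce

lemma topspace_norm_topology [simp]: "topspace (norm_topology V) = carrier V"
  by (simp add: norm_topology_def)

lemma additive_subgroup_closure:
  assumes "additive_subgroup S V"
  shows "additive_subgroup (norm_topology V closure_of S) V"
proof -
  interpret S: additive_subgroup S V by fact
  show ?thesis
  proof (intro additive_subgroup.intro add.subgroupI)
    show "norm_topology V closure_of S \<subseteq> carrier V"
      by (auto simp: closure_of_norm_topology)
    have "\<zero> \<in> norm_topology V closure_of S"
      unfolding closure_of_norm_topology by (auto intro!: bexI[of _ \<zero>] simp: minus_eq norm_minus)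
    then show "norm_topology V closure_of S \<noteq> {}" by auto
  next
    fix x assume "x \<in> norm_topology V closure_of S"
    then have x: "x \<in> carrier V" and *: "\<And>e. e > 0 \<Longrightarrow> \<exists>y\<in>S. y \<in> carrier V \<and> vnorm V (y \<ominus> x) < e"
      by (auto simp: closure_of_norm_topology)
    have "\<exists>y\<in>S. y \<in> carrier V \<and> vnorm V (y \<ominus> (\<ominus> x)) < e" if e: "e > 0" for e
    proof -
      obtain y where y: "y \<in> S" "y \<in> carrier V" "vnorm V (y \<ominus> x) < e"
        using *[OF e] by blast
      have "(\<ominus> y) \<ominus> (\<ominus> x) = \<ominus> (y \<ominus> x)"
        using x y by (simp add: minus_eq minus_add)
      then show ?thesis using x y by (intro bexI[of _ "\<ominus> y"]) (auto simp: norm_minus)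
    qed
    then show "\<ominus> x \<in> norm_topology V closure_of S"
      using x by (auto simp: closure_of_norm_topology)
  next
    fix x x' assume "x \<in> norm_topology V closure_of S" "x' \<in> norm_topology V closure_of S"
    then have x: "x \<in> carrier V" "x' \<in> carrier V"
      and *: "\<And>e. e > 0 \<Longrightarrow> \<exists>y\<in>S. y \<in> carrier V \<and> vnorm V (y \<ominus> x) < e"
      and **: "\<And>e. e > 0 \<Longrightarrow> \<exists>y\<in>S. y \<in> carrier V \<and> vnorm V (y \<ominus> x') < e"
      by (auto simp: closure_of_norm_topology)
    have "\<exists>y\<in>S. y \<in> carrier V \<and> vnorm V (y \<ominus> (x \<oplus> x')) < e" if e: "e > 0" for e
    proof -
      obtain y where y: "y \<in> S" "y \<in> carrier V" "vnorm V (y \<ominus> x) < e/2"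
        using *[of "e/2"] e by auto
      obtain y' where y': "y' \<in> S" "y' \<in> carrier V" "vnorm V (y' \<ominus> x') < e/2"
        using **[of "e/2"] e by auto
      have "vnorm V ((y \<oplus> y') \<ominus> (x \<oplus> x')) \<le> vnorm V (y \<ominus> x) + vnorm V (y' \<ominus> x')"
        using x y y' by (simp add: add_diff_add norm_triangle)
      then show ?thesis using x y y' by (intro bexI[of _ "y \<oplus> y'"]) auto
    qed
    then show "x \<oplus> x' \<in> norm_topology V closure_of S"
      using x by (auto simp: closure_of_norm_topology)
  qed
qed

lemma closure_of_subset_carrier: "S \<subseteq> carrier V \<Longrightarrow> S \<subseteq> norm_topology V closure_of S"
  by (simp add: closure_of_subset)

end

text \<open>Applied with \<open>B\<close> the coboundaries and with \<open>B\<close> their closure,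
  this turns both vanishing conditions into inclusions. Normality of \<open>B\<close> is automatic
  by commutativity, and a quotient is trivial when every coset is \<open>B\<close> itself.\<close>

lemma (in abelian_group) trivial_group_A_Mod_iff:
  assumes Z: "additive_subgroup Z G" and B: "additive_subgroup B G" and "B \<subseteq> Z"
  shows "trivial_group (G\<lparr>carrier := Z\<rparr> A_Mod B) \<longleftrightarrow> Z \<subseteq> B"
proof -
  interpret Z: additive_subgroup Z G by fact
  interpret B: additive_subgroup B G by fact
  let ?Z = "add_monoid (G\<lparr>carrier := Z\<rparr>)"
  have eq: "?Z = (add_monoid G)\<lparr>carrier := Z\<rparr>" by simp
  have subB: "subgroup B ?Z"
    unfolding eq using B.a_subgroup Z.a_subgroup \<open>B \<subseteq> Z\<close>
    by (rule add.subgroup_incl)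
  have comm: "comm_group ?Z"
    unfolding eq using add.subgroup_imp_group[OF Z.a_subgroup]
    by (rule group.group_comm_groupI) (simp add: a_comm)
  then interpret N: normal B ?Z
    using subB by (intro comm_group.normal_iff_subgroup[THEN iffD2])
  interpret Q: group "G\<lparr>carrier := Z\<rparr> A_Mod B"
    unfolding A_FactGroup_def by (rule N.factorgroup_is_group)
  have car: "carrier (G\<lparr>carrier := Z\<rparr> A_Mod B) = rcosets\<^bsub>?Z\<^esub> B"
    by (simp add: A_FactGroup_def FactGroup_def)
  have one: "\<one>\<^bsub>G\<lparr>carrier := Z\<rparr> A_Mod B\<^esub> = B"
    by (simp add: A_FactGroup_def FactGroup_def)
  show ?thesis
    unfolding Q.trivial_group_subset car one
  proof
    assume L: "rcosets\<^bsub>?Z\<^esub> B \<subseteq> {B}"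
    show "Z \<subseteq> B"
    proof
      fix z assume "z \<in> Z"
      then have z: "z \<in> carrier ?Z" by simp
      then have "B #>\<^bsub>?Z\<^esub> z = B" using L by (auto simp: RCOSETS_def)
      then show "z \<in> B" using N.rcos_self[OF z] by (metis N.subgroup_axioms)
    qed
  next
    assume "Z \<subseteq> B"
    then show "rcosets\<^bsub>?Z\<^esub> B \<subseteq> {B}"
      using N.coset_join2[OF _ subB] by (auto simp: RCOSETS_def)
  qed
qed

text \<open>The projection modulo a subgroup is open, so balls project to open sets. If
  \<open>x\<close> and \<open>y\<close> lie in different cosets, then \<open>y \<ominus> x\<close>
  is outside the closed subgroup \<open>B\<close>, hence at some distance \<open>e\<close> from it,
  and the balls of radius \<open>e/2\<close> around \<open>x\<close> and \<open>y\<close> have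
  disjoint projections.\<close>

lemma (in normed_group) Hausdorff_space_quotient:
  assumes Z: "additive_subgroup Z V" and B: "additive_subgroup B V" and "B \<subseteq> Z"
    and closed: "norm_topology V closure_of B \<subseteq> B"
  shows "Hausdorff_space (quotient_topology (subtopology (norm_topology V) Z) (\<lambda>z. B +> z))"
proof -
  interpret Z: additive_subgroup Z V by fact
  interpret B: abelian_subgroup B V
    by (rule abelian_subgroupI3[OF B abelian_group_axioms])
  let ?X = "subtopology (norm_topology V) Z"
  let ?T = "quotient_topology ?X (\<lambda>z. B +> z)"
  have X: "topspace ?X = Z" using Z.a_subset by auto
  have coset: "B +> x = B +> y \<longleftrightarrow> y \<ominus> x \<in> B" if "x \<in> carrier V" "y \<in> carrier V" for x y
    using that B.a_rcos_module B.a_rcos_self B.a_repr_independence'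
    by (metis minus_eq)
  have nbhd: "openin ?T ((\<lambda>z. B +> z) ` (metric.mball x r \<inter> Z))" if x: "x \<in> carrier V" for x r
    unfolding openin_quotient_topology
  proof
    show "(\<lambda>z. B +> z) ` (metric.mball x r \<inter> Z) \<subseteq> (\<lambda>z. B +> z) ` topspace ?X"
      unfolding X by auto
    \<comment> \<open>The preimage of the projected ball is the union of its translates by
      \<open>B\<close>: a translate of a ball is the ball about the translated centre. It stays
      inside \<open>Z\<close> because \<open>B\<close> does.\<close>
    have "{z \<in> topspace ?X. B +> z \<in> (\<lambda>z. B +> z) ` (metric.mball x r \<inter> Z)}
      = (\<Union>b\<in>B. metric.mball (x \<oplus> b) r) \<inter> Z"
    proof (intro Set.set_eqI iffI)
      fix z assume "z \<in> {z \<in> topspace ?X. B +> z \<in> (\<lambda>z. B +> z) ` (metric.mball x r \<inter> Z)}"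
      then obtain u where z: "z \<in> Z" and u: "u \<in> Z" "u \<in> metric.mball x r" "B +> u = B +> z"
        unfolding X by auto
      have car: "z \<in> carrier V" "u \<in> carrier V" using z u Z.a_subset by auto
      then have "z \<ominus> u \<in> B" using u(3) coset by blast
      moreover have "(x \<oplus> (z \<ominus> u)) \<ominus> z = x \<ominus> u"
        using x car by (simp add: minus_eq minus_add a_ac r_neg r_neg1 r_neg2 add_neg_cancel)
      ultimately have "z \<in> metric.mball (x \<oplus> (z \<ominus> u)) r"
        using u(2) x car by (simp only: in_ball) simp
      then show "z \<in> (\<Union>b\<in>B. metric.mball (x \<oplus> b) r) \<inter> Z"
        using z \<open>z \<ominus> u \<in> B\<close> by blast
    next
      fix z assume "z \<in> (\<Union>b\<in>B. metric.mball (x \<oplus> b) r) \<inter> Z"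
      then obtain b where z: "z \<in> Z" and b: "b \<in> B" "z \<in> metric.mball (x \<oplus> b) r" by auto
      have car: "z \<in> carrier V" "b \<in> carrier V" using z b Z.a_subset B.a_subset by auto
      have "z \<ominus> (z \<ominus> b) = b" "x \<ominus> (z \<ominus> b) = (x \<oplus> b) \<ominus> z"
        using x car by (simp_all add: minus_eq minus_add a_ac r_neg r_neg1 r_neg2 add_neg_cancel)
      then have "z \<ominus> b \<in> metric.mball x r" "B +> (z \<ominus> b) = B +> z"
        using b x car by (simp_all only: in_ball coset minus_closed)
      moreover have "z \<ominus> b \<in> Z"
        using z b \<open>B \<subseteq> Z\<close> by (auto simp: minus_eq)
      ultimately show "z \<in> {z \<in> topspace ?X. B +> z \<in> (\<lambda>z. B +> z) ` (metric.mball x r \<inter> Z)}"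
        unfolding X using z by (metis (no_types, lifting) IntI image_eqI mem_Collect_eq)
    qed
    moreover have "openin (norm_topology V) (\<Union>b\<in>B. metric.mball (x \<oplus> b) r)"
      unfolding norm_topology_def by blast
    ultimately show "openin ?X {z \<in> topspace ?X. B +> z \<in> (\<lambda>z. B +> z) ` (metric.mball x r \<inter> Z)}"
      by (metis openin_subtopology_Int)
  qed
  show ?thesis
    unfolding Hausdorff_space_def topspace_quotient_topology X
  proof (intro allI impI)
    fix P Q assume "P \<in> (\<lambda>z. B +> z) ` Z \<and> Q \<in> (\<lambda>z. B +> z) ` Z \<and> P \<noteq> Q"
    then obtain x y where xy: "x \<in> Z" "y \<in> Z" "P = B +> x" "Q = B +> y" "P \<noteq> Q"
      by auto
    have car: "x \<in> carrier V" "y \<in> carrier V" using xy Z.a_subset by auto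
    have "y \<ominus> x \<notin> B" using xy coset car by blast
    then have "y \<ominus> x \<notin> norm_topology V closure_of B" using closed by blast
    then obtain e where e: "e > 0" "\<And>b. b \<in> B \<Longrightarrow> e \<le> vnorm V (b \<ominus> (y \<ominus> x))"
      using car B.a_subset by (fastforce simp: closure_of_norm_topology not_less)
    have "disjnt ((\<lambda>z. B +> z) ` (metric.mball x (e/2) \<inter> Z)) ((\<lambda>z. B +> z) ` (metric.mball y (e/2) \<inter> Z))"
      unfolding disjnt_iff
    proof (intro allI notI, elim conjE imageE)
      fix K u v
      assume u: "u \<in> metric.mball x (e/2) \<inter> Z" and v: "v \<in> metric.mball y (e/2) \<inter> Z"
        and "K = B +> u" "K = B +> v"
      have carr: "u \<in> carrier V" "v \<in> carrier V" using u v Z.a_subset by auto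
      have "v \<ominus> u \<in> B" using coset carr \<open>K = B +> u\<close> \<open>K = B +> v\<close> by blast
      then have "e \<le> vnorm V ((v \<ominus> u) \<ominus> (y \<ominus> x))" by (rule e)
      \<comment> \<open>A common coset would yield the element \<open>v \<ominus> u\<close> of
        \<open>B\<close> at distance less than \<open>e\<close> from
        \<open>y \<ominus> x\<close>.\<close>
      also have "(v \<ominus> u) \<ominus> (y \<ominus> x) = (x \<ominus> u) \<ominus> (y \<ominus> v)"
        using car carr by (simp add: minus_eq minus_add a_ac)
      also have "vnorm V \<dots> \<le> vnorm V (x \<ominus> u) + vnorm V (y \<ominus> v)"
        using car carr by (simp add: norm_diff_le)
      also have "\<dots> < e/2 + e/2"
        using u v by (intro add_strict_mono) (simp_all only: in_ball Int_iff)
      finally show False by simp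
    qed
    moreover have "P \<in> (\<lambda>z. B +> z) ` (metric.mball x (e/2) \<inter> Z)"
      "Q \<in> (\<lambda>z. B +> z) ` (metric.mball y (e/2) \<inter> Z)"
      using xy car e by (auto simp del: metric.in_mball)
    ultimately show "\<exists>U W. openin ?T U \<and> openin ?T W \<and> P \<in> U \<and> Q \<in> W \<and> disjnt U W"
      using nbhd car by blast
  qed
qed

section \<open>Ultraproducts of normed groups\<close>

lemma nonprincipal_ultrafilter_ge:
  assumes "nonprincipal_ultrafilter \<U>"
  shows "eventually (\<lambda>k::nat. M \<le> k) \<U>"
proof (induction M)
  case (Suc M)
  have "eventually (\<lambda>k. k \<noteq> M) \<U>"
    using assms unfolding nonprincipal_ultrafilter_def by metis
  with Suc show ?case by eventually_elim auto
qed simp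

lemma nonprincipal_ultrafilter_not:
  "\<lbrakk>nonprincipal_ultrafilter \<U>; \<not> eventually P \<U>\<rbrakk> \<Longrightarrow> eventually (\<lambda>k. \<not> P k) \<U>"
  by (auto simp: nonprincipal_ultrafilter_def)

text \<open>A form of countable saturation. \<open>m k\<close> is the largest
  \<open>j \<le> k\<close> with \<open>P j k\<close>: the cap by \<open>k\<close> makes the maximum
  exist, and it is harmless because the ultrafilter contains every tail. Taking a maximum handles
  conditions \<open>P m\<close> that are not nested.\<close>

lemma ultrafilter_diagonal:
  assumes U: "nonprincipal_ultrafilter \<U>" and P: "\<And>m. eventually (P m) \<U>"
  obtains m :: "nat \<Rightarrow> nat" where "filterlim m at_top \<U>" "eventually (\<lambda>k. P (m k) k) \<U>"
proof
  define S where "S k = {j. j \<le> k \<and> P j k}" for k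
  define m where "m k = (if S k = {} then 0 else Max (S k))" for k
  have fin: "finite (S k)" for k by (simp add: S_def)
  show "filterlim m at_top \<U>"
    unfolding filterlim_at_top
  proof
    fix M
    show "eventually (\<lambda>k. M \<le> m k) \<U>"
      using P[of M] nonprincipal_ultrafilter_ge[OF U, of M]
    proof eventually_elim
      case (elim k)
      then have "M \<in> S k" by (simp add: S_def)
      then show ?case using fin Max_ge by (auto simp: m_def)
    qed
  qed
  \<comment> \<open>Wherever \<open>P 0 k\<close> holds, \<open>S k\<close> is nonempty, so
    \<open>m k\<close> is a genuine maximum and not the default 0.\<close>
  show "eventually (\<lambda>k. P (m k) k) \<U>"
    using P[of 0]
  proof eventually_elim
    case (elim k)
    then have "0 \<in> S k" by (simp add: S_def)
    then have "Max (S k) \<in> S k" "S k \<noteq> {}" using fin Max_in by blast+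
    then show ?case by (simp add: m_def) (simp add: S_def)
  qed
qed

text \<open>The image filter lives on a compact interval and so has a cluster point. For an
  ultrafilter a cluster point is a limit: if a neighbourhood were not eventually entered, its
  complement would be.\<close>

lemma ultrafilter_bounded_convergent:
  fixes f :: "'i \<Rightarrow> real"
  assumes U: "nonprincipal_ultrafilter \<U>" and bdd: "\<And>i. \<bar>f i\<bar> \<le> R"
  obtains L where "(f \<longlongrightarrow> L) \<U>"
proof -
  have "filtermap f \<U> \<noteq> bot"
    using U by (simp add: nonprincipal_ultrafilter_def filtermap_bot_iff)
  moreover have "eventually (\<lambda>x. x \<in> {-R..R}) (filtermap f \<U>)"
    using bdd by (auto simp: eventually_filtermap abs_le_iff minus_le_iff intro!: always_eventually)
  ultimately obtain L where L: "inf (nhds L) (filtermap f \<U>) \<noteq> bot"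
    using compact_Icc[of "-R" R] unfolding compact_filter by blast
  have "(f \<longlongrightarrow> L) \<U>"
  proof (rule topological_tendstoI)
    fix S assume S: "open S" "L \<in> S"
    show "eventually (\<lambda>i. f i \<in> S) \<U>"
    proof (rule ccontr)
      assume "\<not> eventually (\<lambda>i. f i \<in> S) \<U>"
      then have "eventually (\<lambda>i. f i \<notin> S) \<U>"
        by (rule nonprincipal_ultrafilter_not[OF U])
      then have "eventually (\<lambda>x. x \<notin> S) (filtermap f \<U>)"
        by (simp add: eventually_filtermap)
      moreover have "eventually (\<lambda>x. x \<in> S) (nhds L)"
        using S by (rule eventually_nhds_in_open)
      ultimately have "eventually (\<lambda>x. False) (inf (nhds L) (filtermap f \<U>))"
        unfolding eventually_inf by blast
      then show False using L by (simp add: eventually_False)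
    qed
  qed
  then show ?thesis by (rule that)
qed

section \<open>Bounded operators\<close>

definition bounded_operator ::
  "'a normed_module \<Rightarrow> 'b normed_module \<Rightarrow> real \<Rightarrow> ('a \<Rightarrow> 'b) \<Rightarrow> bool" where
  "bounded_operator V W D f \<longleftrightarrow>
     f \<in> carrier V \<rightarrow> carrier W \<and>
     (\<forall>x\<in>carrier V. \<forall>y\<in>carrier V. f (x \<oplus>\<^bsub>V\<^esub> y) = f x \<oplus>\<^bsub>W\<^esub> f y) \<and>
     (\<forall>c. \<forall>x\<in>carrier V. f (c \<odot>\<^bsub>V\<^esub> x) = c \<odot>\<^bsub>W\<^esub> f x) \<and>
     (\<forall>x\<in>carrier V. vnorm W (f x) \<le> D * vnorm V x)"

context
  fixes V :: "'a normed_module" and W :: "'b normed_module" and D f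
  assumes V: "normed_group V" and W: "normed_group W" and f: "bounded_operator V W D f"
begin

interpretation V: normed_group V by (rule V)
interpretation W: normed_group W by (rule W)

lemma bounded_operator_closed: "x \<in> carrier V \<Longrightarrow> f x \<in> carrier W"
  using f by (auto simp: bounded_operator_def)

text \<open>Obtained from additivity and cancellation, since a \<open>normed_group\<close> comes
  with no laws for its scalars.\<close>

lemma bounded_operator_minus: "x \<in> carrier V \<Longrightarrow> f (\<ominus>\<^bsub>V\<^esub> x) = \<ominus>\<^bsub>W\<^esub> f x"
proof -
  assume x: "x \<in> carrier V"
  have add: "f (x \<oplus>\<^bsub>V\<^esub> y) = f x \<oplus>\<^bsub>W\<^esub> f y" if "x \<in> carrier V" "y \<in> carrier V" for x y
    using f that by (auto simp: bounded_operator_def)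
  have "f \<zero>\<^bsub>V\<^esub> = \<zero>\<^bsub>W\<^esub>"
    using add[of "\<zero>\<^bsub>V\<^esub>" "\<zero>\<^bsub>V\<^esub>"] bounded_operator_closed[of "\<zero>\<^bsub>V\<^esub>"]
    by (metis V.l_zero V.zero_closed W.add.r_cancel_one')
  then have "f (\<ominus>\<^bsub>V\<^esub> x) \<oplus>\<^bsub>W\<^esub> f x = \<zero>\<^bsub>W\<^esub>"
    using add[of "\<ominus>\<^bsub>V\<^esub> x" x] x by (simp add: V.l_neg)
  then show ?thesis
    using x bounded_operator_closed by (metis V.a_inv_closed W.minus_equality)
qed

lemma bounded_operator_diff:
  "\<lbrakk>x \<in> carrier V; y \<in> carrier V\<rbrakk> \<Longrightarrow> f (x \<ominus>\<^bsub>V\<^esub> y) = f x \<ominus>\<^bsub>W\<^esub> f y"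
  using f bounded_operator_minus by (auto simp: bounded_operator_def V.minus_eq W.minus_eq)

end

section \<open>The ultraproduct as a normed group\<close>

locale normed_group_sequence =
  fixes \<U> :: "nat filter" and V :: "nat \<Rightarrow> 'a normed_module"
  assumes ultra: "nonprincipal_ultrafilter \<U>" and normed: "\<And>k. normed_group (V k)"
begin

sublocale V: normed_group "V k" for k
  by (rule normed)

abbreviation "bseq \<equiv> bounded_sequences V"
abbreviation "null \<equiv> null_sequences \<U> V"
abbreviation "cls \<equiv> uclass \<U> V"
abbreviation "UP \<equiv> ultraproduct \<U> V"

lemma ultra_nontrivial: "\<U> \<noteq> bot"
  using ultra by (simp add: nonprincipal_ultrafilter_def)

lemma bseqI: "\<lbrakk>\<And>k. x k \<in> carrier (V k); \<And>k. vnorm (V k) (x k) \<le> R\<rbrakk> \<Longrightarrow> x \<in> carrier bseq"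
  by (auto simp: bounded_sequences_def intro!: bdd_aboveI[of _ R])

lemma bseq_carrier: "x \<in> carrier bseq \<Longrightarrow> x k \<in> carrier (V k)"
  by (auto simp: bounded_sequences_def)

lemma bseq_bound:
  assumes "x \<in> carrier bseq" obtains R where "0 < R" "\<And>k. vnorm (V k) (x k) \<le> R"
proof -
  obtain R where "\<And>k. vnorm (V k) (x k) \<le> R"
    using assms by (auto simp: bounded_sequences_def bdd_above_def)
  then have "\<And>k. vnorm (V k) (x k) \<le> max R 1" by (meson max.coboundedI1)
  then show ?thesis using that[of "max R 1"] by simp
qed

lemma bseq_simps:
  "\<zero>\<^bsub>bseq\<^esub> = (\<lambda>k. \<zero>\<^bsub>V k\<^esub>)" "x \<oplus>\<^bsub>bseq\<^esub> y = (\<lambda>k. x k \<oplus>\<^bsub>V k\<^esub> y k)"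
  by (simp_all add: bounded_sequences_def)

lemma bseq_minus_closed: "x \<in> carrier bseq \<Longrightarrow> (\<lambda>k. \<ominus>\<^bsub>V k\<^esub> x k) \<in> carrier bseq"
  by (metis (no_types, lifting) bseqI bseq_bound bseq_carrier V.a_inv_closed V.norm_minus)

lemma bseq_add_closed:
  assumes x: "x \<in> carrier bseq" and y: "y \<in> carrier bseq"
  shows "(\<lambda>k. x k \<oplus>\<^bsub>V k\<^esub> y k) \<in> carrier bseq"
proof -
  obtain R where R: "\<And>k. vnorm (V k) (x k) \<le> R" using x bseq_bound by blast
  obtain R' where R': "\<And>k. vnorm (V k) (y k) \<le> R'" using y bseq_bound by blast
  have car: "x k \<in> carrier (V k)" "y k \<in> carrier (V k)" for k
    using x y bseq_carrier by auto
  show ?thesis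
  proof (rule bseqI)
    fix k
    show "vnorm (V k) (x k \<oplus>\<^bsub>V k\<^esub> y k) \<le> R + R'"
      using V.norm_triangle[OF car] R[of k] R'[of k] by (meson add_mono order_trans)
  qed (simp add: car)
qed

lemma abelian_group_bseq: "abelian_group bseq"
proof (rule abelian_groupI)
  show "\<zero>\<^bsub>bseq\<^esub> \<in> carrier bseq"
    unfolding bseq_simps by (rule bseqI[of _ 0]) auto
next
  fix x assume x: "x \<in> carrier bseq"
  then show "\<exists>y\<in>carrier bseq. y \<oplus>\<^bsub>bseq\<^esub> x = \<zero>\<^bsub>bseq\<^esub>"
    using bseq_minus_closed
    by (intro bexI[of _ "\<lambda>k. \<ominus>\<^bsub>V k\<^esub> x k"]) (auto simp: bseq_simps bseq_carrier V.l_neg)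
qed (auto simp: bseq_simps bseq_carrier V.a_ac bseq_add_closed)

sublocale B: abelian_group bseq
  by (rule abelian_group_bseq)

lemma bseq_minus: "x \<in> carrier bseq \<Longrightarrow> \<ominus>\<^bsub>bseq\<^esub> x = (\<lambda>k. \<ominus>\<^bsub>V k\<^esub> x k)"
  by (rule B.minus_equality)
    (auto simp: bseq_simps bseq_carrier V.l_neg bseq_minus_closed)

lemma bseq_diff:
  "\<lbrakk>x \<in> carrier bseq; y \<in> carrier bseq\<rbrakk> \<Longrightarrow> x \<ominus>\<^bsub>bseq\<^esub> y = (\<lambda>k. x k \<ominus>\<^bsub>V k\<^esub> y k)"
  by (simp add: B.minus_eq V.minus_eq bseq_minus bseq_simps)

lemma null_iff: "x \<in> null \<longleftrightarrow> x \<in> carrier bseq \<and> ((\<lambda>k. vnorm (V k) (x k)) \<longlongrightarrow> 0) \<U>"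
  by (simp add: null_sequences_def)

lemma additive_subgroup_null: "additive_subgroup null bseq"
proof (intro additive_subgroup.intro B.add.subgroupI)
  show "null \<subseteq> carrier bseq" by (auto simp: null_iff)
  have "\<zero>\<^bsub>bseq\<^esub> \<in> null" by (simp add: null_iff) (simp add: bseq_simps)
  then show "null \<noteq> {}" by auto
next
  fix x assume "x \<in> null"
  then show "\<ominus>\<^bsub>bseq\<^esub> x \<in> null"
    by (simp add: null_iff bseq_minus bseq_minus_closed V.norm_minus bseq_carrier)
next
  fix x y assume x: "x \<in> null" and y: "y \<in> null"
  then have car: "x k \<in> carrier (V k)" "y k \<in> carrier (V k)" for k
    by (auto simp: null_iff bseq_carrier)
  have "((\<lambda>k. vnorm (V k) (x k) + vnorm (V k) (y k)) \<longlongrightarrow> 0) \<U>"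
    using x y tendsto_add[of _ 0 \<U> _ 0] by (auto simp: null_iff)
  then have "((\<lambda>k. vnorm (V k) (x k \<oplus>\<^bsub>V k\<^esub> y k)) \<longlongrightarrow> 0) \<U>"
    by (rule tendsto_sandwich[of "\<lambda>_. 0", rotated 3])
      (auto intro!: always_eventually V.norm_triangle simp: car)
  then show "x \<oplus>\<^bsub>bseq\<^esub> y \<in> null"
    using x y by (simp add: null_iff) (simp add: bseq_simps)
qed

sublocale N: abelian_subgroup null bseq
  by (rule abelian_subgroupI3[OF additive_subgroup_null abelian_group_bseq])

lemma carrier_UP: "carrier UP = cls ` carrier bseq"
  by (auto simp: ultraproduct_def uclass_def A_RCOSETS_def' a_r_coset_def)

lemma cls_closed [simp]: "x \<in> carrier bseq \<Longrightarrow> cls x \<in> carrier UP"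
  by (simp add: carrier_UP)

lemma UP_cases:
  assumes "X \<in> carrier UP" obtains x where "x \<in> carrier bseq" "X = cls x"
  using assms by (auto simp: carrier_UP)

lemma mem_cls_iff:
  assumes "x \<in> carrier bseq"
  shows "y \<in> cls x \<longleftrightarrow> y \<in> carrier bseq \<and> ((\<lambda>k. vnorm (V k) (y k \<ominus>\<^bsub>V k\<^esub> x k)) \<longlongrightarrow> 0) \<U>"
proof (cases "y \<in> carrier bseq")
  case True
  have "y \<in> cls x \<longleftrightarrow> y \<ominus>\<^bsub>bseq\<^esub> x \<in> null"
    unfolding uclass_def B.minus_eq using N.a_rcos_module[OF assms True] .
  also have "\<dots> \<longleftrightarrow> ((\<lambda>k. vnorm (V k) (y k \<ominus>\<^bsub>V k\<^esub> x k)) \<longlongrightarrow> 0) \<U>"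
    using assms True by (simp add: null_iff) (simp add: bseq_diff)
  finally show ?thesis using True by simp
next
  case False
  then show ?thesis
    using N.a_elemrcos_carrier[OF assms] by (auto simp: uclass_def)
qed

lemma cls_self: "x \<in> carrier bseq \<Longrightarrow> x \<in> cls x"
  unfolding uclass_def by (rule N.a_rcos_self)

lemma cls_eq_iff:
  assumes "x \<in> carrier bseq" "y \<in> carrier bseq"
  shows "cls x = cls y \<longleftrightarrow> ((\<lambda>k. vnorm (V k) (x k \<ominus>\<^bsub>V k\<^esub> y k)) \<longlongrightarrow> 0) \<U>"
proof -
  have "cls x = cls y \<longleftrightarrow> x \<in> cls y"
    using assms N.a_repr_independence' cls_self unfolding uclass_def by metis
  then show ?thesis using mem_cls_iff assms by simp
qed

lemma zero_UP: "\<zero>\<^bsub>UP\<^esub> = cls \<zero>\<^bsub>bseq\<^esub>"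
  using N.a_rcos_const[OF N.zero_closed] by (simp add: ultraproduct_def uclass_def)

lemma cls_eq_zero_iff:
  assumes "x \<in> carrier bseq"
  shows "cls x = \<zero>\<^bsub>UP\<^esub> \<longleftrightarrow> ((\<lambda>k. vnorm (V k) (x k)) \<longlongrightarrow> 0) \<U>"
proof -
  have "x k \<ominus>\<^bsub>V k\<^esub> \<zero>\<^bsub>V k\<^esub> = x k" for k
    using bseq_carrier[OF assms] by (simp add: V.minus_eq)
  then show ?thesis
    using cls_eq_iff[OF assms B.zero_closed] by (simp add: zero_UP bseq_simps)
qed

lemma add_UP:
  "\<lbrakk>x \<in> carrier bseq; y \<in> carrier bseq\<rbrakk> \<Longrightarrow> cls x \<oplus>\<^bsub>UP\<^esub> cls y = cls (x \<oplus>\<^bsub>bseq\<^esub> y)"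
  by (simp add: ultraproduct_def uclass_def N.a_rcos_sum)

lemma abelian_group_UP: "abelian_group UP"
proof (rule abelian_groupI)
  fix X assume "X \<in> carrier UP"
  then obtain x where x: "x \<in> carrier bseq" "X = cls x" by (rule UP_cases)
  then show "\<exists>Y\<in>carrier UP. Y \<oplus>\<^bsub>UP\<^esub> X = \<zero>\<^bsub>UP\<^esub>"
    by (intro bexI[of _ "cls (\<ominus>\<^bsub>bseq\<^esub> x)"]) (simp_all add: add_UP zero_UP B.l_neg)
qed (auto simp: add_UP zero_UP B.a_ac elim!: UP_cases)

sublocale UP: abelian_group UP
  by (rule abelian_group_UP)

lemma minus_UP: "x \<in> carrier bseq \<Longrightarrow> \<ominus>\<^bsub>UP\<^esub> cls x = cls (\<ominus>\<^bsub>bseq\<^esub> x)"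
  by (rule UP.minus_equality) (simp_all add: add_UP zero_UP B.l_neg)

lemma diff_UP:
  "\<lbrakk>x \<in> carrier bseq; y \<in> carrier bseq\<rbrakk> \<Longrightarrow> cls x \<ominus>\<^bsub>UP\<^esub> cls y = cls (x \<ominus>\<^bsub>bseq\<^esub> y)"
  by (simp add: UP.minus_eq B.minus_eq minus_UP add_UP)

text \<open>The norm of a class is defined through one arbitrarily chosen representative
  \<open>y\<close>. Norms of bounded sequences converge along an ultrafilter, and those of
  \<open>x\<close> and \<open>y\<close> differ by a null sequence, so every representative computes
  the same limit.\<close>

lemma tendsto_vnorm_UP:
  assumes x: "x \<in> carrier bseq"
  shows "((\<lambda>k. vnorm (V k) (x k)) \<longlongrightarrow> vnorm UP (cls x)) \<U>"
proof -
  define y where "y = (SOME y. y \<in> cls x)"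
  have "y \<in> cls x" unfolding y_def by (rule someI[of "\<lambda>y. y \<in> cls x", OF cls_self[OF x]])
  then have y: "y \<in> carrier bseq"
    and lim: "((\<lambda>k. vnorm (V k) (y k \<ominus>\<^bsub>V k\<^esub> x k)) \<longlongrightarrow> 0) \<U>"
    using mem_cls_iff[OF x] by auto
  have car: "x k \<in> carrier (V k)" "y k \<in> carrier (V k)" for k
    using x y bseq_carrier by auto
  obtain R where "\<And>k. vnorm (V k) (x k) \<le> R" using bseq_bound[OF x] by blast
  then have "\<bar>vnorm (V k) (x k)\<bar> \<le> R" for k using car by simp
  then obtain L where L: "((\<lambda>k. vnorm (V k) (x k)) \<longlongrightarrow> L) \<U>"
    using ultrafilter_bounded_convergent[OF ultra, of "\<lambda>k. vnorm (V k) (x k)" R] by blast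
  have "((\<lambda>k. vnorm (V k) (y k) - vnorm (V k) (x k)) \<longlongrightarrow> 0) \<U>"
  proof (rule Lim_null_comparison[OF always_eventually lim], rule allI)
    fix k
    show "norm (vnorm (V k) (y k) - vnorm (V k) (x k)) \<le> vnorm (V k) (y k \<ominus>\<^bsub>V k\<^esub> x k)"
      using V.norm_le_add_diff[OF car, of k] V.norm_le_add_diff[OF car(2,1), of k]
        V.norm_diff_commute[OF car, of k]
      by (simp add: abs_le_iff algebra_simps)
  qed
  from tendsto_add[OF this L] have "((\<lambda>k. vnorm (V k) (y k)) \<longlongrightarrow> L) \<U>" by simp
  then have "Lim \<U> (\<lambda>k. vnorm (V k) (y k)) = L"
    using ultra_nontrivial by (rule tendsto_Lim[rotated])
  then have "vnorm UP (cls x) = L"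
    by (simp add: ultraproduct_def y_def)
  then show ?thesis using L by simp
qed

lemma vnorm_UP_eqI:
  "\<lbrakk>x \<in> carrier bseq; ((\<lambda>k. vnorm (V k) (x k)) \<longlongrightarrow> L) \<U>\<rbrakk> \<Longrightarrow> vnorm UP (cls x) = L"
  using tendsto_unique[OF ultra_nontrivial tendsto_vnorm_UP] by blast

lemma normed_group_UP: "normed_group UP"
proof (intro normed_group.intro abelian_group_UP normed_group_axioms.intro)
  fix X assume "X \<in> carrier UP"
  then obtain x where x: "x \<in> carrier bseq" "X = cls x" by (rule UP_cases)
  then show "vnorm UP X = 0 \<longleftrightarrow> X = \<zero>\<^bsub>UP\<^esub>"
    using tendsto_vnorm_UP vnorm_UP_eqI by (metis cls_eq_zero_iff)
  show "vnorm UP (\<ominus>\<^bsub>UP\<^esub> X) = vnorm UP X"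
    using tendsto_vnorm_UP[OF x(1)] x vnorm_UP_eqI[of "\<ominus>\<^bsub>bseq\<^esub> x"]
    by (simp add: minus_UP) (simp add: bseq_minus V.norm_minus bseq_carrier)
next
  fix X Y assume "X \<in> carrier UP" "Y \<in> carrier UP"
  then obtain x y where x: "x \<in> carrier bseq" "X = cls x" and y: "y \<in> carrier bseq" "Y = cls y"
    by (metis UP_cases)
  have "((\<lambda>k. vnorm (V k) ((x \<oplus>\<^bsub>bseq\<^esub> y) k)) \<longlongrightarrow> vnorm UP (X \<oplus>\<^bsub>UP\<^esub> Y)) \<U>"
    using x y by (simp add: add_UP tendsto_vnorm_UP)
  moreover have "((\<lambda>k. vnorm (V k) (x k) + vnorm (V k) (y k)) \<longlongrightarrow> vnorm UP X + vnorm UP Y) \<U>"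
    using x y by (intro tendsto_add) (simp_all add: tendsto_vnorm_UP)
  ultimately show "vnorm UP (X \<oplus>\<^bsub>UP\<^esub> Y) \<le> vnorm UP X + vnorm UP Y"
    using ultra_nontrivial
    by (intro tendsto_le[of \<U>]) (auto intro!: always_eventually V.norm_triangle
        simp: bseq_simps bseq_carrier x y)
qed

sublocale UP: normed_group UP
  by (rule normed_group_UP)

lemma eventually_less_of_vnorm_UP:
  assumes "x \<in> carrier bseq" "y \<in> carrier bseq" "vnorm UP (cls x \<ominus>\<^bsub>UP\<^esub> cls y) < e"
  shows "eventually (\<lambda>k. vnorm (V k) (x k \<ominus>\<^bsub>V k\<^esub> y k) < e) \<U>"
proof -
  have "((\<lambda>k. vnorm (V k) ((x \<ominus>\<^bsub>bseq\<^esub> y) k)) \<longlongrightarrow> vnorm UP (cls x \<ominus>\<^bsub>UP\<^esub> cls y)) \<U>"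
    using assms by (simp add: diff_UP tendsto_vnorm_UP)
  then show ?thesis
    using assms order_tendstoD(2) by (fastforce simp: bseq_diff)
qed

text \<open>Counterpart of \<open>eventually_less_of_vnorm_UP\<close>: strict bounds descend from
  the limit to almost every level, but only weak bounds survive the passage back.\<close>

lemma vnorm_UP_le:
  assumes "x \<in> carrier bseq" "y \<in> carrier bseq"
    and "eventually (\<lambda>k. vnorm (V k) (x k \<ominus>\<^bsub>V k\<^esub> y k) \<le> e) \<U>"
  shows "vnorm UP (cls x \<ominus>\<^bsub>UP\<^esub> cls y) \<le> e"
proof -
  have "((\<lambda>k. vnorm (V k) ((x \<ominus>\<^bsub>bseq\<^esub> y) k)) \<longlongrightarrow> vnorm UP (cls x \<ominus>\<^bsub>UP\<^esub> cls y)) \<U>"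
    using assms by (simp add: diff_UP tendsto_vnorm_UP)
  then show ?thesis
    using assms ultra_nontrivial
    by (intro tendsto_upperbound[where F = \<U>]) (auto simp: bseq_diff)
qed

end

section \<open>Operators induced on ultraproducts, their kernels and images\<close>

locale ultraproduct_operator =
  V: normed_group_sequence \<U> V + W: normed_group_sequence \<U> W
  for \<U> and V :: "nat \<Rightarrow> 'a normed_module" and W :: "nat \<Rightarrow> 'b normed_module" +
  fixes f :: "nat \<Rightarrow> 'a \<Rightarrow> 'b" and D :: real
  assumes operator: "\<And>k. bounded_operator (V k) (W k) D (f k)"
begin

lemmas f_closed = bounded_operator_closed[OF V.normed W.normed operator]
lemmas f_diff = bounded_operator_diff[OF V.normed W.normed operator]

lemma f_add: "\<lbrakk>x \<in> carrier (V k); y \<in> carrier (V k)\<rbrakk> \<Longrightarrow> f k (x \<oplus>\<^bsub>V k\<^esub> y) = f k x \<oplus>\<^bsub>W k\<^esub> f k y"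
  using operator by (auto simp: bounded_operator_def)

lemma f_norm: "x \<in> carrier (V k) \<Longrightarrow> vnorm (W k) (f k x) \<le> D * vnorm (V k) x"
  using operator by (auto simp: bounded_operator_def)

text \<open>\<open>D\<close> may be negative when the spaces are trivial; with the absolute value,
  estimates can be multiplied monotonically.\<close>

lemma f_norm': "x \<in> carrier (V k) \<Longrightarrow> vnorm (W k) (f k x) \<le> \<bar>D\<bar> * vnorm (V k) x"
  using f_norm[of x k] V.V.norm_nonneg[of x k] by (smt (verit) mult_right_mono)

lemma f_bseq:
  assumes "x \<in> carrier V.bseq" shows "(\<lambda>k. f k (x k)) \<in> carrier W.bseq"
proof -
  obtain R where R: "\<And>k. vnorm (V k) (x k) \<le> R" using V.bseq_bound[OF assms] by blast
  show ?thesis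
  proof (rule W.bseqI)
    fix k
    show "vnorm (W k) (f k (x k)) \<le> \<bar>D\<bar> * R"
      using f_norm'[OF V.bseq_carrier[OF assms], of k] mult_left_mono[OF R, of "\<bar>D\<bar>" k] by simp
  qed (simp add: f_closed V.bseq_carrier[OF assms])
qed

lemma ultra_map_cls:
  assumes x: "x \<in> carrier V.bseq"
  shows "ultra_map \<U> W f (V.cls x) = W.cls (\<lambda>k. f k (x k))"
proof -
  have "W.cls (\<lambda>k. f k (y k)) = W.cls (\<lambda>k. f k (x k))" if "y \<in> V.cls x" for y
  proof -
    have y: "y \<in> carrier V.bseq"
      and lim: "((\<lambda>k. vnorm (V k) (y k \<ominus>\<^bsub>V k\<^esub> x k)) \<longlongrightarrow> 0) \<U>"
      using that V.mem_cls_iff[OF x] by auto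
    have "((\<lambda>k. \<bar>D\<bar> * vnorm (V k) (y k \<ominus>\<^bsub>V k\<^esub> x k)) \<longlongrightarrow> 0) \<U>"
      using tendsto_mult_right_zero[OF lim] by simp
    then have "((\<lambda>k. vnorm (W k) (f k (y k) \<ominus>\<^bsub>W k\<^esub> f k (x k))) \<longlongrightarrow> 0) \<U>"
    proof (rule tendsto_sandwich[of "\<lambda>_. 0", rotated 3])
      show "\<forall>\<^sub>F k in \<U>. vnorm (W k) (f k (y k) \<ominus>\<^bsub>W k\<^esub> f k (x k)) \<le> \<bar>D\<bar> * vnorm (V k) (y k \<ominus>\<^bsub>V k\<^esub> x k)"
        using x y f_norm' by (auto simp: V.bseq_carrier simp flip: f_diff intro!: always_eventually)
    qed (auto simp: f_closed V.bseq_carrier x y)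
    then show ?thesis using W.cls_eq_iff f_bseq x y by blast
  qed
  then show ?thesis unfolding ultra_map_def using V.cls_self[OF x] by blast
qed

lemma abelian_group_hom_ultra_map: "abelian_group_hom V.UP W.UP (ultra_map \<U> W f)"
proof (intro abelian_group_homI V.abelian_group_UP W.abelian_group_UP group_hom.intro
    V.UP.a_group W.UP.a_group group_hom_axioms.intro homI)
  fix X assume "X \<in> carrier (add_monoid V.UP)"
  then show "ultra_map \<U> W f X \<in> carrier (add_monoid W.UP)"
    by (auto elim!: V.UP_cases simp: ultra_map_cls f_bseq)
next
  fix X Y assume "X \<in> carrier (add_monoid V.UP)" "Y \<in> carrier (add_monoid V.UP)"
  then show "ultra_map \<U> W f (X \<otimes>\<^bsub>add_monoid V.UP\<^esub> Y) =
      ultra_map \<U> W f X \<otimes>\<^bsub>add_monoid W.UP\<^esub> ultra_map \<U> W f Y"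
    by (auto simp: ultra_map_cls f_bseq V.add_UP W.add_UP V.bseq_simps W.bseq_simps f_add
        V.bseq_carrier V.bseq_add_closed elim!: V.UP_cases)
qed

sublocale hom: abelian_group_hom V.UP W.UP "ultra_map \<U> W f"
  by (rule abelian_group_hom_ultra_map)

lemma additive_subgroup_image: "additive_subgroup (ultra_map \<U> W f ` carrier V.UP) W.UP"
  using group_hom.img_is_subgroup[OF hom.a_group_hom] by (simp add: additive_subgroup.intro)

text \<open>A class in the kernel may have \<open>f k (x k)\<close> nonzero at every level. This is
  why exactness at a level has to be formulated for approximate cycles.\<close>

lemma cls_mem_kernel_iff:
  assumes "x \<in> carrier V.bseq"
  shows "V.cls x \<in> a_kernel V.UP W.UP (ultra_map \<U> W f) \<longleftrightarrow>
    ((\<lambda>k. vnorm (W k) (f k (x k))) \<longlongrightarrow> 0) \<U>"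
  using assms by (simp add: a_kernel_def' ultra_map_cls W.cls_eq_zero_iff f_bseq)

text \<open>The second diagonal argument: approximate preimages become an exact one in the
  ultraproduct. At level \<open>k\<close> a solution with error \<open>e (m k)\<close> is chosen,
  where \<open>m k\<close> tends to infinity. It is decisive that \<open>M\<close> does not depend
  on \<open>m\<close>, for otherwise the chosen sequence could be unbounded and would define no
  class.\<close>

lemma cls_mem_imageI:
  assumes z: "z \<in> carrier W.bseq" and e: "e \<longlonglongrightarrow> 0"
    and ev: "\<And>m. eventually (\<lambda>k. \<exists>x\<in>carrier (V k). vnorm (V k) x \<le> M \<and>
      vnorm (W k) (f k x \<ominus>\<^bsub>W k\<^esub> z k) \<le> e m) \<U>"
  shows "W.cls z \<in> ultra_map \<U> W f ` carrier V.UP"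
proof -
  define P where "P m k x \<longleftrightarrow> x \<in> carrier (V k) \<and> vnorm (V k) x \<le> M \<and>
    vnorm (W k) (f k x \<ominus>\<^bsub>W k\<^esub> z k) \<le> e m" for m k x
  have "eventually (\<lambda>k. \<exists>x. P m k x) \<U>" for m
    using ev[of m] by (rule eventually_mono) (auto simp: P_def)
  then obtain m where m: "filterlim m at_top \<U>" "eventually (\<lambda>k. \<exists>x. P (m k) k x) \<U>"
    using ultrafilter_diagonal[OF V.ultra, of "\<lambda>m k. \<exists>x. P m k x"] by blast
  \<comment> \<open>A bounded sequence must lie in the carriers at all levels, hence the default
    zero where no solution exists. The bound \<open>max M 0\<close> below covers that
    default.\<close>
  define x where "x k = (if \<exists>x. P (m k) k x then SOME x. P (m k) k x else \<zero>\<^bsub>V k\<^esub>)" for k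
  have x: "P (m k) k (x k)" if "\<exists>x. P (m k) k x" for k
    using that unfolding x_def by (auto intro: someI_ex)
  have "x k \<in> carrier (V k) \<and> vnorm (V k) (x k) \<le> max M 0" for k
    using x[of k] by (cases "\<exists>x. P (m k) k x") (auto simp: x_def P_def)
  then have bx: "x \<in> carrier V.bseq" by (auto intro: V.bseqI)
  have lim: "((\<lambda>k. e (m k)) \<longlongrightarrow> 0) \<U>"
    using filterlim_compose[OF e m(1)] .
  have le: "\<forall>\<^sub>F k in \<U>. vnorm (W k) (f k (x k) \<ominus>\<^bsub>W k\<^esub> z k) \<le> e (m k)"
    using m(2) by (rule eventually_mono) (drule x, simp add: P_def)
  have "((\<lambda>k. vnorm (W k) (f k (x k) \<ominus>\<^bsub>W k\<^esub> z k)) \<longlongrightarrow> 0) \<U>"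
    by (rule tendsto_sandwich[OF _ le tendsto_const lim])
      (auto simp: f_closed V.bseq_carrier W.bseq_carrier bx z)
  then have "ultra_map \<U> W f (V.cls x) = W.cls z"
    using W.cls_eq_iff[OF f_bseq[OF bx] z] by (simp add: ultra_map_cls bx)
  then show ?thesis using bx by (metis V.cls_closed imageI)
qed

text \<open>Translates density in the ultraproduct into statements about levels. The sequence
  \<open>x\<close> is bounded for each \<open>e\<close>, but its bound may grow as \<open>e\<close>
  shrinks.\<close>

lemma cls_mem_closure_image_iff:
  assumes z: "z \<in> carrier W.bseq"
  shows "W.cls z \<in> norm_topology W.UP closure_of (ultra_map \<U> W f ` carrier V.UP) \<longleftrightarrow>
    (\<forall>e>0. \<exists>x\<in>carrier V.bseq. eventually (\<lambda>k. vnorm (W k) (f k (x k) \<ominus>\<^bsub>W k\<^esub> z k) < e) \<U>)"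
proof
  assume L: "W.cls z \<in> norm_topology W.UP closure_of (ultra_map \<U> W f ` carrier V.UP)"
  show "\<forall>e>0. \<exists>x\<in>carrier V.bseq. eventually (\<lambda>k. vnorm (W k) (f k (x k) \<ominus>\<^bsub>W k\<^esub> z k) < e) \<U>"
  proof (intro allI impI)
    fix e :: real assume "e > 0"
    then obtain X where X: "X \<in> carrier V.UP" "vnorm W.UP (ultra_map \<U> W f X \<ominus>\<^bsub>W.UP\<^esub> W.cls z) < e"
      using L by (auto simp: W.UP.closure_of_norm_topology)
    then obtain x where x: "x \<in> carrier V.bseq" "X = V.cls x" using V.UP_cases by blast
    then show "\<exists>x\<in>carrier V.bseq. eventually (\<lambda>k. vnorm (W k) (f k (x k) \<ominus>\<^bsub>W k\<^esub> z k) < e) \<U>"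
      using W.eventually_less_of_vnorm_UP[OF f_bseq z] X by (auto simp: ultra_map_cls)
  qed
next
  assume R: "\<forall>e>0. \<exists>x\<in>carrier V.bseq. eventually (\<lambda>k. vnorm (W k) (f k (x k) \<ominus>\<^bsub>W k\<^esub> z k) < e) \<U>"
  have "\<exists>Y\<in>ultra_map \<U> W f ` carrier V.UP. Y \<in> carrier W.UP \<and> vnorm W.UP (Y \<ominus>\<^bsub>W.UP\<^esub> W.cls z) < e"
    if e: "e > 0" for e
  proof -
    \<comment> \<open>Half of \<open>e\<close> restores strictness, as the limit preserves only the
      weak inequality.\<close>
    obtain x where x: "x \<in> carrier V.bseq"
      and "eventually (\<lambda>k. vnorm (W k) (f k (x k) \<ominus>\<^bsub>W k\<^esub> z k) < e/2) \<U>"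
      using R e by (meson half_gt_zero)
    then have "eventually (\<lambda>k. vnorm (W k) (f k (x k) \<ominus>\<^bsub>W k\<^esub> z k) \<le> e/2) \<U>"
      by (auto elim: eventually_mono)
    then have "vnorm W.UP (ultra_map \<U> W f (V.cls x) \<ominus>\<^bsub>W.UP\<^esub> W.cls z) \<le> e/2"
      unfolding ultra_map_cls[OF x] by (rule W.vnorm_UP_le[OF f_bseq[OF x] z])
    then show ?thesis
      using x e by (intro bexI[of _ "ultra_map \<U> W f (V.cls x)"]) auto
  qed
  then show "W.cls z \<in> norm_topology W.UP closure_of (ultra_map \<U> W f ` carrier V.UP)"
    using z by (auto simp: W.UP.closure_of_norm_topology)
qed

end

section \<open>Approximate exactness\<close>

text \<open>Scalars enter at the single levels, where vectors are rescaled to the unit ball. The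
  ultraproduct is handled as a normed group: kernels, cosets and closures are all additive
  notions.\<close>

locale normed_vector_space = normed_group V for V :: "'a normed_module" (structure) +
  assumes smult_closed [simp]: "x \<in> carrier V \<Longrightarrow> c \<odot> x \<in> carrier V"
    and smult_add_left: "x \<in> carrier V \<Longrightarrow> (a + b) \<odot> x = a \<odot> x \<oplus> b \<odot> x"
    and smult_add_right: "\<lbrakk>x \<in> carrier V; y \<in> carrier V\<rbrakk> \<Longrightarrow> c \<odot> (x \<oplus> y) = c \<odot> x \<oplus> c \<odot> y"
    and smult_smult: "x \<in> carrier V \<Longrightarrow> a \<odot> (b \<odot> x) = (a * b) \<odot> x"
    and smult_one [simp]: "x \<in> carrier V \<Longrightarrow> 1 \<odot> x = x"
    and norm_smult: "x \<in> carrier V \<Longrightarrow> vnorm V (c \<odot> x) = \<bar>c\<bar> * vnorm V x"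
begin

lemma smult_zero_left [simp]: "x \<in> carrier V \<Longrightarrow> 0 \<odot> x = \<zero>"
  using norm_smult[of x 0] by (simp add: norm_eq_0)

lemma smult_uminus: "x \<in> carrier V \<Longrightarrow> (- c) \<odot> x = \<ominus> (c \<odot> x)"
  using smult_add_left[of x "- c" c] by (intro minus_equality[symmetric]) auto

lemma smult_minus_right: "x \<in> carrier V \<Longrightarrow> c \<odot> (\<ominus> x) = \<ominus> (c \<odot> x)"
  using smult_smult[of x c "- 1"] by (simp add: smult_uminus)

lemma smult_diff_right: "\<lbrakk>x \<in> carrier V; y \<in> carrier V\<rbrakk> \<Longrightarrow> c \<odot> (x \<ominus> y) = c \<odot> x \<ominus> c \<odot> y"
  by (simp add: minus_eq smult_add_right smult_minus_right)

end

lemma normed_space_imp_normed_vector_space: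
  assumes "normed_space V" shows "normed_vector_space V"
proof -
  interpret module real_scalars V
    using assms by (simp add: normed_space_def)
  have S [simp]: "carrier real_scalars = UNIV" "x \<oplus>\<^bsub>real_scalars\<^esub> y = x + y"
    "x \<otimes>\<^bsub>real_scalars\<^esub> y = x * y" "\<one>\<^bsub>real_scalars\<^esub> = 1" "\<zero>\<^bsub>real_scalars\<^esub> = 0" for x y
    by (simp_all add: real_scalars_def)
  have S' [simp]: "\<ominus>\<^bsub>real_scalars\<^esub> x = - x" for x
    by (rule R.minus_equality) simp_all
  have N: "vnorm V (c \<odot>\<^bsub>V\<^esub> x) = \<bar>c\<bar> * vnorm V x" if "x \<in> carrier V" for c x
    using assms that by (simp add: normed_space_def)
  show ?thesis
  proof
    fix x assume x: "x \<in> carrier V"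
    then show "vnorm V (\<ominus>\<^bsub>V\<^esub> x) = vnorm V x"
      using N[OF x, of "- 1"] smult_l_minus[of 1 x] smult_one[OF x] by simp
  next
    fix x a b assume "x \<in> carrier V"
    then show "(a + b) \<odot>\<^bsub>V\<^esub> x = a \<odot>\<^bsub>V\<^esub> x \<oplus>\<^bsub>V\<^esub> b \<odot>\<^bsub>V\<^esub> x"
      using smult_l_distr[of a b x] by simp
  next
    fix x a b assume "x \<in> carrier V"
    then show "a \<odot>\<^bsub>V\<^esub> (b \<odot>\<^bsub>V\<^esub> x) = (a * b) \<odot>\<^bsub>V\<^esub> x"
      using smult_assoc1[of a b x] by simp
  next
    fix x assume "x \<in> carrier V"
    then show "1 \<odot>\<^bsub>V\<^esub> x = x" using smult_one by simp
  qed (use assms N smult_r_distr in \<open>auto simp: normed_space_def\<close>)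
qed

text \<open>A quantitative exactness at \<open>B\<close>, robust enough to be read off from the
  ultraproduct. Any factor below 1 in place of 1/2 would drive the geometric iteration.\<close>

definition approximately_exact ::
  "'a normed_module \<Rightarrow> 'b normed_module \<Rightarrow> 'c normed_module \<Rightarrow> ('a \<Rightarrow> 'b) \<Rightarrow> ('b \<Rightarrow> 'c) \<Rightarrow>
    real \<Rightarrow> real \<Rightarrow> bool" where
  "approximately_exact A B C d d' K \<delta> \<longleftrightarrow>
     (\<forall>z\<in>carrier B. vnorm B z \<le> 1 \<longrightarrow> vnorm C (d' z) \<le> \<delta> \<longrightarrow>
        (\<exists>a\<in>carrier A. vnorm A a \<le> K \<and> vnorm B (d a \<ominus>\<^bsub>B\<^esub> z) \<le> 1/2))"

section \<open>Iteration at a fixed level\<close>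

locale approximately_exact_complex =
  A: normed_vector_space A + B: normed_vector_space B + C: normed_vector_space C
  for A :: "'a normed_module" and B :: "'b normed_module" and C :: "'c normed_module" +
  fixes d d' D D' K \<delta>
  assumes d: "bounded_operator A B D d" and d': "bounded_operator B C D' d'"
    and complex: "\<And>a. a \<in> carrier A \<Longrightarrow> d' (d a) = \<zero>\<^bsub>C\<^esub>"
    and K: "0 < K" and \<delta>: "0 < \<delta>"
    and exact: "approximately_exact A B C d d' K \<delta>"
begin

lemmas d_closed [simp] = bounded_operator_closed[OF A.normed_group_axioms B.normed_group_axioms d]
lemmas d'_closed [simp] = bounded_operator_closed[OF B.normed_group_axioms C.normed_group_axioms d']
lemmas d'_diff = bounded_operator_diff[OF B.normed_group_axioms C.normed_group_axioms d']

text \<open>The invariant of both iterations: corrections by boundaries leave the smallness of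
  \<open>d' z\<close> intact.\<close>

lemma d'_correct: "\<lbrakk>z \<in> carrier B; a \<in> carrier A\<rbrakk> \<Longrightarrow> d' (z \<ominus>\<^bsub>B\<^esub> d a) = d' z"
  by (simp add: d'_diff complex C.minus_eq)

text \<open>The homogeneous form of \<open>exact\<close>: it is applied to \<open>z\<close> divided
  by \<open>r\<close>, and the resulting \<open>a\<close> is multiplied by \<open>r\<close>.\<close>

lemma approximate_primitive:
  assumes z: "z \<in> carrier B" and r: "0 < r" "vnorm B z \<le> r" "vnorm C (d' z) \<le> \<delta> * r"
  obtains a where "a \<in> carrier A" "vnorm A a \<le> K * r" "vnorm B (z \<ominus>\<^bsub>B\<^esub> d a) \<le> r / 2"
proof -
  let ?z = "(1 / r) \<odot>\<^bsub>B\<^esub> z"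
  have "d' ?z = (1 / r) \<odot>\<^bsub>C\<^esub> d' z"
    using d' z by (simp add: bounded_operator_def)
  then have "vnorm C (d' ?z) \<le> \<delta>" "vnorm B ?z \<le> 1"
    using z r by (simp_all add: C.norm_smult B.norm_smult divide_le_eq)
  then obtain a where a: "a \<in> carrier A" "vnorm A a \<le> K" "vnorm B (d a \<ominus>\<^bsub>B\<^esub> ?z) \<le> 1/2"
    using exact z unfolding approximately_exact_def by (meson B.smult_closed)
  have "z \<ominus>\<^bsub>B\<^esub> d (r \<odot>\<^bsub>A\<^esub> a) = r \<odot>\<^bsub>B\<^esub> (?z \<ominus>\<^bsub>B\<^esub> d a)"
    using d a z r by (simp add: bounded_operator_def B.smult_diff_right B.smult_smult)
  then have "vnorm B (z \<ominus>\<^bsub>B\<^esub> d (r \<odot>\<^bsub>A\<^esub> a)) \<le> r * (1/2)"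
    using a z r B.norm_diff_commute[of "d a" ?z] mult_left_mono[OF a(3), of r]
    by (simp add: B.norm_smult)
  moreover have "vnorm A (r \<odot>\<^bsub>A\<^esub> a) \<le> K * r"
    using a r by (simp add: A.norm_smult mult.commute)
  ultimately show ?thesis using that[of "r \<odot>\<^bsub>A\<^esub> a"] a by simp
qed

text \<open>A residue of size \<open>r / 2 ^ j\<close> can be halved as long as \<open>d' z\<close>
  is at most \<delta> times that size, at the cost of a correction of norm
  \<open>K * (r / 2 ^ j)\<close>. The bound on \<open>a\<close> is the sum of these costs for
  \<open>j < J\<close>, a partial geometric sum that stays below \<open>2 * K * r\<close>.\<close>

lemma iterated_primitive:
  assumes z: "z \<in> carrier B" and r: "0 < r" "vnorm B z \<le> r"
  shows "vnorm C (d' z) \<le> \<delta> * r / 2 ^ J \<Longrightarrow>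
    \<exists>a\<in>carrier A. vnorm A a \<le> 2 * K * r * (1 - 1 / 2 ^ J) \<and> vnorm B (z \<ominus>\<^bsub>B\<^esub> d a) \<le> r / 2 ^ J"
proof (induction J)
  case 0
  have "vnorm B (d \<zero>\<^bsub>A\<^esub>) \<le> D * vnorm A \<zero>\<^bsub>A\<^esub>"
    using d unfolding bounded_operator_def by blast
  then have "d \<zero>\<^bsub>A\<^esub> = \<zero>\<^bsub>B\<^esub>"
    using B.norm_nonneg[of "d \<zero>\<^bsub>A\<^esub>"] B.norm_eq_0[of "d \<zero>\<^bsub>A\<^esub>"]
    by (simp add: order_antisym)
  then show ?case
    using z r by (intro bexI[of _ "\<zero>\<^bsub>A\<^esub>"]) simp_all
next
  case (Suc J)
  have "\<delta> * r / 2 ^ Suc J \<le> \<delta> * r / 2 ^ J"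
    using \<delta> r by (intro divide_left_mono) auto
  with Suc.prems have le: "vnorm C (d' z) \<le> \<delta> * r / 2 ^ J" by linarith
  with Suc.IH obtain a where a: "a \<in> carrier A" "vnorm A a \<le> 2 * K * r * (1 - 1 / 2 ^ J)"
    "vnorm B (z \<ominus>\<^bsub>B\<^esub> d a) \<le> r / 2 ^ J" by blast
  obtain b where b: "b \<in> carrier A" "vnorm A b \<le> K * (r / 2 ^ J)"
    "vnorm B ((z \<ominus>\<^bsub>B\<^esub> d a) \<ominus>\<^bsub>B\<^esub> d b) \<le> r / 2 ^ J / 2"
    using approximate_primitive[of "z \<ominus>\<^bsub>B\<^esub> d a" "r / 2 ^ J"] z a le r
    by (auto simp: d'_correct)
  have "z \<ominus>\<^bsub>B\<^esub> d (a \<oplus>\<^bsub>A\<^esub> b) = (z \<ominus>\<^bsub>B\<^esub> d a) \<ominus>\<^bsub>B\<^esub> d b"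
    using d z a b by (simp add: bounded_operator_def B.minus_eq B.minus_add B.a_ac)
  moreover have "vnorm A (a \<oplus>\<^bsub>A\<^esub> b) \<le> 2 * K * r * (1 - 1 / 2 ^ J) + K * (r / 2 ^ J)"
    using A.norm_triangle[OF a(1) b(1)] a b by linarith
  moreover have "2 * K * r * (1 - 1 / 2 ^ J) + K * (r / 2 ^ J) = 2 * K * r * (1 - 1 / 2 ^ Suc J)"
    by (simp add: field_simps)
  ultimately show ?case using a b by (intro bexI[of _ "a \<oplus>\<^bsub>A\<^esub> b"]) (auto simp: mult.commute)
qed

text \<open>The same halving, now used to shrink \<open>b\<close> itself: each correction lowers
  \<open>N\<close> by one and keeps \<open>d' b\<close>. The number of halvings depends on
  \<open>b\<close>, the final bound \<open>r\<close> does not.\<close>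

lemma small_preimage_aux:
  assumes r: "0 < r"
  shows "\<lbrakk>b \<in> carrier B; vnorm C (d' b) \<le> \<delta> * r; vnorm B b \<le> r * 2 ^ N\<rbrakk> \<Longrightarrow>
    \<exists>b'\<in>carrier B. d' b' = d' b \<and> vnorm B b' \<le> r"
proof (induction N arbitrary: b)
  case (Suc N)
  have "r * 1 \<le> r * 2 ^ Suc N"
    using r by (intro mult_left_mono one_le_power) auto
  then have "\<delta> * r \<le> \<delta> * (r * 2 ^ Suc N)"
    using \<delta> by (intro mult_left_mono) auto
  then have "vnorm C (d' b) \<le> \<delta> * (r * 2 ^ Suc N)" using Suc.prems(2) by linarith
  moreover have "0 < r * 2 ^ Suc N" using r by simp
  ultimately obtain a where a: "a \<in> carrier A" "vnorm B (b \<ominus>\<^bsub>B\<^esub> d a) \<le> r * 2 ^ Suc N / 2"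
    using approximate_primitive[of b "r * 2 ^ Suc N"] Suc.prems by metis
  then show ?case
    using Suc.IH[of "b \<ominus>\<^bsub>B\<^esub> d a"] Suc.prems by (auto simp: d'_correct)
qed auto

text \<open>An open mapping estimate for \<open>d'\<close> onto its image, with a constant
  1/\<delta> that is common to all levels where \<open>exact\<close> holds.\<close>

lemma small_preimage:
  assumes r: "0 < r" and b: "b \<in> carrier B" "vnorm C (d' b) \<le> \<delta> * r"
  obtains b' where "b' \<in> carrier B" "d' b' = d' b" "vnorm B b' \<le> r"
proof -
  obtain N where "vnorm B b / r < 2 ^ N"
    using real_arch_pow[of 2 "vnorm B b / r"] by auto
  then have "vnorm B b \<le> r * 2 ^ N"
    using r by (simp add: field_simps)
  then show ?thesis using small_preimage_aux[OF r b] that by blast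
qed

end

section \<open>Transfer between the levels and the ultraproduct\<close>

locale ultraproduct_complex =
  d: ultraproduct_operator \<U> A B d D + d': ultraproduct_operator \<U> B C d' D'
  for \<U> and A :: "nat \<Rightarrow> 'a normed_module" and B :: "nat \<Rightarrow> 'b normed_module"
    and C :: "nat \<Rightarrow> 'c normed_module" and d D d' D' +
  assumes vector_spaces:
      "\<And>k. normed_vector_space (A k)" "\<And>k. normed_vector_space (B k)" "\<And>k. normed_vector_space (C k)"
    and complex: "\<And>k a. a \<in> carrier (A k) \<Longrightarrow> d' k (d k a) = \<zero>\<^bsub>C k\<^esub>"
begin

abbreviation "boundaries \<equiv> ultra_map \<U> B d ` carrier d.V.UP"
abbreviation "cycles \<equiv> a_kernel d.W.UP d'.W.UP (ultra_map \<U> C d')"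

lemma approximately_exact_complex:
  assumes "0 < K" "0 < \<delta>" "approximately_exact (A k) (B k) (C k) (d k) (d' k) K \<delta>"
  shows "approximately_exact_complex (A k) (B k) (C k) (d k) (d' k) D D' K \<delta>"
  using assms vector_spaces complex d.operator d'.operator
  by (simp add: approximately_exact_complex_def approximately_exact_complex_axioms_def)

text \<open>Cycles are closed because \<open>d'\<close> is uniformly bounded: if \<open>d x\<close>
  is close to \<open>z\<close>, then \<open>d' z\<close> agrees up to sign with \<open>d'\<close> of
  the small difference, as \<open>d' (d x)\<close> vanishes.\<close>

lemma closure_boundaries_subset_cycles:
  "norm_topology d.W.UP closure_of boundaries \<subseteq> cycles"
proof
  fix Z assume Z: "Z \<in> norm_topology d.W.UP closure_of boundaries"
  then obtain z where z: "z \<in> carrier d.W.bseq" "Z = d.W.cls z"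
    by (auto simp: d.W.UP.closure_of_norm_topology elim: d.W.UP_cases)
  have "((\<lambda>k. vnorm (C k) (d' k (z k))) \<longlongrightarrow> 0) \<U>"
  proof (rule tendstoI)
    fix e :: real assume e: "e > 0"
    \<comment> \<open>The added 1 prevents division by zero and makes the final inequality
      strict.\<close>
    define e' where "e' = e / (\<bar>D'\<bar> + 1)"
    have e': "e' > 0" using e by (simp add: e'_def)
    then obtain x where x: "x \<in> carrier d.V.bseq"
      and ev: "eventually (\<lambda>k. vnorm (B k) (d k (x k) \<ominus>\<^bsub>B k\<^esub> z k) < e') \<U>"
      using Z z d.cls_mem_closure_image_iff by blast
    show "eventually (\<lambda>k. dist (vnorm (C k) (d' k (z k))) 0 < e) \<U>"
      using ev
    proof eventually_elim
      case (elim k)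
      have car: "x k \<in> carrier (A k)" "z k \<in> carrier (B k)"
        using x z d.V.bseq_carrier d.W.bseq_carrier by auto
      have "vnorm (C k) (d' k (z k)) = vnorm (C k) (d' k (d k (x k) \<ominus>\<^bsub>B k\<^esub> z k))"
        using car by (simp add: d.f_closed d'.f_closed d'.f_diff complex d'.W.V.minus_eq d'.W.V.norm_minus)
      also have "\<dots> \<le> \<bar>D'\<bar> * vnorm (B k) (d k (x k) \<ominus>\<^bsub>B k\<^esub> z k)"
        using car by (intro d'.f_norm') (simp add: d.f_closed)
      also have "\<dots> \<le> \<bar>D'\<bar> * e'" using elim by (intro mult_left_mono) auto
      also have "\<dots> < e" using e by (simp add: e'_def field_simps)
      finally show ?case using car by (simp add: d'.f_closed)
    qed
  qed
  then show "Z \<in> cycles" using z d'.cls_mem_kernel_iff by simp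
qed

lemma boundaries_subset_closure: "boundaries \<subseteq> norm_topology d.W.UP closure_of boundaries"
  by (rule d.W.UP.closure_of_subset_carrier) (rule additive_subgroup.a_subset[OF d.additive_subgroup_image])

lemma boundaries_subset_cycles: "boundaries \<subseteq> cycles"
  using boundaries_subset_closure closure_boundaries_subset_cycles by blast

text \<open>If no constants worked, then for each \<open>m\<close> the pair \<open>Suc m\<close> and
  its inverse would fail at almost every level. A diagonal sequence of the counterexamples
  represents a cocycle, since \<open>d'\<close> of it tends to 0. Density puts it within 1/2 of the
  image of a bounded sequence, against the choice of the counterexamples.\<close>

lemma eventually_approximately_exact:
  assumes dense: "cycles \<subseteq> norm_topology d.W.UP closure_of boundaries"
  obtains K \<delta> where "0 < K" "0 < \<delta>"
    "eventually (\<lambda>k. approximately_exact (A k) (B k) (C k) (d k) (d' k) K \<delta>) \<U>"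
proof (rule ccontr)
  assume neg: "\<not> thesis"
  define P where "P m k z \<longleftrightarrow> z \<in> carrier (B k) \<and> vnorm (B k) z \<le> 1 \<and>
    vnorm (C k) (d' k z) \<le> inverse (real (Suc m)) \<and>
    (\<forall>a\<in>carrier (A k). vnorm (A k) a \<le> real (Suc m) \<longrightarrow> 1/2 < vnorm (B k) (d k a \<ominus>\<^bsub>B k\<^esub> z))" for m k z
  have "eventually (\<lambda>k. \<exists>z. P m k z) \<U>" for m
  proof -
    have "\<not> eventually (\<lambda>k. approximately_exact (A k) (B k) (C k) (d k) (d' k)
        (real (Suc m)) (inverse (real (Suc m)))) \<U>"
      using neg that[of "real (Suc m)" "inverse (real (Suc m))"] by auto
    \<comment> \<open>This is where the ultrafilter property matters: failing to hold almost
      everywhere becomes failing almost everywhere.\<close>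
    then have "eventually (\<lambda>k. \<not> approximately_exact (A k) (B k) (C k) (d k) (d' k)
        (real (Suc m)) (inverse (real (Suc m)))) \<U>"
      by (rule nonprincipal_ultrafilter_not[OF d.V.ultra])
    then show ?thesis
      by (rule eventually_mono) (fastforce simp: approximately_exact_def P_def not_le)
  qed
  then obtain m where m: "filterlim m at_top \<U>" "eventually (\<lambda>k. \<exists>z. P (m k) k z) \<U>"
    using ultrafilter_diagonal[OF d.V.ultra, of "\<lambda>m k. \<exists>z. P m k z"] by blast
  define z where "z k = (if \<exists>z. P (m k) k z then SOME z. P (m k) k z else \<zero>\<^bsub>B k\<^esub>)" for k
  have z: "P (m k) k (z k)" if "\<exists>z. P (m k) k z" for k
    using that unfolding z_def by (auto intro: someI_ex)
  have "z k \<in> carrier (B k) \<and> vnorm (B k) (z k) \<le> 1" for k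
    using z[of k] by (cases "\<exists>z. P (m k) k z") (auto simp: z_def P_def)
  then have bz: "z \<in> carrier d.W.bseq" by (auto intro: d.W.bseqI)
  have lim: "((\<lambda>k. inverse (real (Suc (m k)))) \<longlongrightarrow> 0) \<U>"
    using filterlim_compose[OF LIMSEQ_inverse_real_of_nat m(1)] .
  have le: "\<forall>\<^sub>F k in \<U>. vnorm (C k) (d' k (z k)) \<le> inverse (real (Suc (m k)))"
    using m(2) by (rule eventually_mono) (drule z, simp add: P_def)
  have "((\<lambda>k. vnorm (C k) (d' k (z k))) \<longlongrightarrow> 0) \<U>"
    by (rule tendsto_sandwich[OF _ le tendsto_const lim])
      (auto simp: d'.f_closed d.W.bseq_carrier bz)
  then have "d.W.cls z \<in> norm_topology d.W.UP closure_of boundaries"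
    using dense d'.cls_mem_kernel_iff[OF bz] by blast
  then obtain x where x: "x \<in> carrier d.V.bseq"
    and ev: "eventually (\<lambda>k. vnorm (B k) (d k (x k) \<ominus>\<^bsub>B k\<^esub> z k) < 1/2) \<U>"
    using d.cls_mem_closure_image_iff[OF bz] by (meson half_gt_zero zero_less_one)
  obtain R where R: "\<And>k. vnorm (A k) (x k) \<le> R" using d.V.bseq_bound[OF x] by blast
  \<comment> \<open>Once \<open>m k\<close> exceeds \<open>R\<close>, the vector \<open>x k\<close>
    is among the primitives that the counterexample \<open>z k\<close> rules out.\<close>
  have "eventually (\<lambda>k. nat \<lceil>R\<rceil> \<le> m k) \<U>"
    using m(1) unfolding filterlim_at_top by blast
  with m(2) ev have "eventually (\<lambda>k. False) \<U>"
  proof eventually_elim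
    case (elim k)
    have "vnorm (A k) (x k) \<le> real (Suc (m k))"
      using R[of k] elim(3) by linarith
    then show False
      using z[OF elim(1)] elim(2) d.V.bseq_carrier[OF x, of k] by (auto simp: P_def)
  qed
  then show False using d.V.ultra_nontrivial by (simp add: eventually_False)
qed

context
  fixes K \<delta>
  assumes K: "0 < K" and \<delta>: "0 < \<delta>"
    and exact: "eventually (\<lambda>k. approximately_exact (A k) (B k) (C k) (d k) (d' k) K \<delta>) \<U>"
begin

text \<open>As \<open>d' z\<close> tends to 0, for each fixed \<open>J\<close> almost every level
  admits \<open>J\<close> halvings of the error.\<close>

lemma cycles_subset_boundaries: "cycles \<subseteq> boundaries"
proof
  fix Z assume Z: "Z \<in> cycles"
  then obtain z where z: "z \<in> carrier d.W.bseq" "Z = d.W.cls z"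
    by (auto simp: a_kernel_def' elim: d.W.UP_cases)
  with Z have lim: "((\<lambda>k. vnorm (C k) (d' k (z k))) \<longlongrightarrow> 0) \<U>"
    using d'.cls_mem_kernel_iff by simp
  obtain R where R: "0 < R" "\<And>k. vnorm (B k) (z k) \<le> R" using d.W.bseq_bound[OF z(1)] by blast
  have "(\<lambda>J. R * (1/2) ^ J) \<longlonglongrightarrow> 0"
    by (rule tendsto_mult_right_zero) (rule LIMSEQ_power_zero, simp)
  moreover have "eventually (\<lambda>k. \<exists>x\<in>carrier (A k). vnorm (A k) x \<le> 2 * K * R \<and>
      vnorm (B k) (d k x \<ominus>\<^bsub>B k\<^esub> z k) \<le> R * (1/2) ^ J) \<U>" for J
  proof -
    have "0 < \<delta> * R / 2 ^ J" using \<delta> R by simp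
    with lim have "eventually (\<lambda>k. vnorm (C k) (d' k (z k)) < \<delta> * R / 2 ^ J) \<U>"
      by (rule order_tendstoD)
    with exact show ?thesis
    proof eventually_elim
      case (elim k)
      interpret approximately_exact_complex "A k" "B k" "C k" "d k" "d' k" D D' K \<delta>
        using elim K \<delta> by (intro approximately_exact_complex)
      have zk: "z k \<in> carrier (B k)" using z d.W.bseq_carrier by auto
      obtain a where a: "a \<in> carrier (A k)" "vnorm (A k) a \<le> 2 * K * R * (1 - 1 / 2 ^ J)"
        "vnorm (B k) (z k \<ominus>\<^bsub>B k\<^esub> d k a) \<le> R / 2 ^ J"
        using iterated_primitive[OF zk R(1) R(2)] elim(2) by (meson less_imp_le)
      \<comment> \<open>Weakening to a bound independent of \<open>J\<close>, as
        \<open>cls_mem_imageI\<close> demands.\<close>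
      have "2 * K * R * (1 - 1 / 2 ^ J) \<le> 2 * K * R"
        using K R by (intro mult_left_le) auto
      then show ?case
        using a zk d.W.V.norm_diff_commute[of "d k a" k "z k"]
        by (intro bexI[of _ a]) (auto simp: power_divide)
    qed
  qed
  ultimately show "Z \<in> boundaries"
    unfolding z(2) using z(1) by (intro d.cls_mem_imageI)
qed

text \<open>Approximations \<open>d' x\<close> of \<open>y\<close> come with \<open>x\<close> whose
  size may grow with the precision. \<open>small_preimage\<close> exchanges \<open>x\<close> for a
  vector with the same image and norm at most \<open>r\<close>, uniformly in the precision.\<close>

lemma closure_next_boundaries_subset:
  "norm_topology d'.W.UP closure_of (ultra_map \<U> C d' ` carrier d.W.UP)
    \<subseteq> ultra_map \<U> C d' ` carrier d.W.UP"
proof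
  fix Y assume Y: "Y \<in> norm_topology d'.W.UP closure_of (ultra_map \<U> C d' ` carrier d.W.UP)"
  then obtain y where y: "y \<in> carrier d'.W.bseq" "Y = d'.W.cls y"
    by (auto simp: d'.W.UP.closure_of_norm_topology elim: d'.W.UP_cases)
  obtain R where R: "0 < R" "\<And>k. vnorm (C k) (y k) \<le> R" using d'.W.bseq_bound[OF y(1)] by blast
  \<comment> \<open>\<open>R\<close> bounds \<open>y\<close> and 1 bounds every error
    \<open>inverse (real (Suc m))\<close>, so \<open>d' x\<close> has norm at most
    \<open>R + 1\<close>, which is \<delta> times \<open>r\<close>.\<close>
  define r where "r = (R + 1) / \<delta>"
  have r: "0 < r" using R \<delta> by (simp add: r_def)
  have "eventually (\<lambda>k. \<exists>b\<in>carrier (B k). vnorm (B k) b \<le> r \<and>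
      vnorm (C k) (d' k b \<ominus>\<^bsub>C k\<^esub> y k) \<le> inverse (real (Suc m))) \<U>" for m
  proof -
    have "0 < inverse (real (Suc m))" by simp
    then obtain x where x: "x \<in> carrier d.W.bseq"
      and "eventually (\<lambda>k. vnorm (C k) (d' k (x k) \<ominus>\<^bsub>C k\<^esub> y k) < inverse (real (Suc m))) \<U>"
      using Y d'.cls_mem_closure_image_iff[OF y(1)] unfolding y(2) by meson
    from this(2) exact show ?thesis
    proof eventually_elim
      case (elim k)
      interpret approximately_exact_complex "A k" "B k" "C k" "d k" "d' k" D D' K \<delta>
        using elim K \<delta> by (intro approximately_exact_complex)
      have car: "x k \<in> carrier (B k)" "y k \<in> carrier (C k)"
        using x y d.W.bseq_carrier d'.W.bseq_carrier by auto
      have "inverse (real (Suc m)) \<le> 1" by (simp add: inverse_le_1_iff)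
      then have "vnorm (C k) (d' k (x k)) \<le> R + 1"
        using d'.W.V.norm_le_add_diff[of "d' k (x k)" k "y k"] car R(2)[of k] elim(1) by (simp add: d'.f_closed)
      also have "R + 1 = \<delta> * r" using \<delta> by (simp add: r_def)
      finally obtain b where "b \<in> carrier (B k)" "d' k b = d' k (x k)" "vnorm (B k) b \<le> r"
        using small_preimage[OF r car(1)] by blast
      then show ?case using elim(1) by (intro bexI[of _ b]) auto
    qed
  qed
  then show "Y \<in> ultra_map \<U> C d' ` carrier d.W.UP"
    unfolding y(2) using y(1) LIMSEQ_inverse_real_of_nat by (intro d'.cls_mem_imageI)
qed

end

end

section \<open>The complex of bounded cochains\<close>

context
  fixes V :: "'a normed_module" and S :: "'s set"
  assumes V: "normed_vector_space V" and S: "S \<noteq> {}"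
begin

interpretation V: normed_vector_space V by (rule V)

lemma linfty_carrierI:
  "\<lbrakk>\<And>s. s \<in> S \<Longrightarrow> f s \<in> carrier V; \<And>s. s \<in> S \<Longrightarrow> vnorm V (f s) \<le> R\<rbrakk> \<Longrightarrow>
    (\<lambda>s\<in>S. f s) \<in> carrier (linfty S V)"
  by (auto simp: linfty_def intro!: bdd_aboveI[of _ R])

lemma linfty_closed: "\<lbrakk>f \<in> carrier (linfty S V); s \<in> S\<rbrakk> \<Longrightarrow> f s \<in> carrier V"
  by (auto simp: linfty_def)

lemma linfty_eqI:
  assumes "f \<in> carrier (linfty S V)" "g \<in> carrier (linfty S V)" "\<And>s. s \<in> S \<Longrightarrow> f s = g s"
  shows "f = g"
  using assms by (auto simp: linfty_def intro: PiE_ext)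

lemma le_norm_linfty: "\<lbrakk>f \<in> carrier (linfty S V); s \<in> S\<rbrakk> \<Longrightarrow> vnorm V (f s) \<le> vnorm (linfty S V) f"
  by (auto simp: linfty_def intro: cSUP_upper)

text \<open>Nonemptiness of \<open>S\<close> matters here: over the empty set the real supremum is
  an unspecified value.\<close>

lemma norm_linfty_le: "(\<And>s. s \<in> S \<Longrightarrow> vnorm V (f s) \<le> R) \<Longrightarrow> vnorm (linfty S V) f \<le> R"
  using S by (auto simp: linfty_def intro: cSUP_least)

lemma linfty_simps:
  "\<zero>\<^bsub>linfty S V\<^esub> = (\<lambda>s\<in>S. \<zero>\<^bsub>V\<^esub>)"
  "f \<oplus>\<^bsub>linfty S V\<^esub> g = (\<lambda>s\<in>S. f s \<oplus>\<^bsub>V\<^esub> g s)"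
  "c \<odot>\<^bsub>linfty S V\<^esub> f = (\<lambda>s\<in>S. c \<odot>\<^bsub>V\<^esub> f s)"
  by (simp_all add: linfty_def)

lemma linfty_add_closed:
  assumes f: "f \<in> carrier (linfty S V)" and g: "g \<in> carrier (linfty S V)"
  shows "(\<lambda>s\<in>S. f s \<oplus>\<^bsub>V\<^esub> g s) \<in> carrier (linfty S V)"
proof (rule linfty_carrierI)
  fix s assume s: "s \<in> S"
  show "f s \<oplus>\<^bsub>V\<^esub> g s \<in> carrier V" using f g s by (simp add: linfty_closed)
  show "vnorm V (f s \<oplus>\<^bsub>V\<^esub> g s) \<le> vnorm (linfty S V) f + vnorm (linfty S V) g"
    using V.norm_triangle[of "f s" "g s"] le_norm_linfty[OF f s] le_norm_linfty[OF g s]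
      linfty_closed[OF f s] linfty_closed[OF g s] by linarith
qed

lemma linfty_smult_closed:
  assumes f: "f \<in> carrier (linfty S V)"
  shows "(\<lambda>s\<in>S. c \<odot>\<^bsub>V\<^esub> f s) \<in> carrier (linfty S V)"
proof (rule linfty_carrierI)
  fix s assume s: "s \<in> S"
  show "c \<odot>\<^bsub>V\<^esub> f s \<in> carrier V" using f s by (simp add: linfty_closed)
  show "vnorm V (c \<odot>\<^bsub>V\<^esub> f s) \<le> \<bar>c\<bar> * vnorm (linfty S V) f"
    using le_norm_linfty[OF f s] by (simp add: V.norm_smult linfty_closed[OF f s] mult_left_mono)
qed

lemma linfty_minus_closed:
  assumes f: "f \<in> carrier (linfty S V)"
  shows "(\<lambda>s\<in>S. \<ominus>\<^bsub>V\<^esub> f s) \<in> carrier (linfty S V)"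
proof -
  have "(\<lambda>s\<in>S. \<ominus>\<^bsub>V\<^esub> f s) = (\<lambda>s\<in>S. (- 1) \<odot>\<^bsub>V\<^esub> f s)"
    using f by (intro restrict_ext) (simp add: V.smult_uminus linfty_closed)
  then show ?thesis using linfty_smult_closed[OF f] by simp
qed

lemma linfty_zero_closed: "(\<lambda>s\<in>S. \<zero>\<^bsub>V\<^esub>) \<in> carrier (linfty S V)"
  by (rule linfty_carrierI[where R = 0]) auto

lemma abelian_group_linfty: "abelian_group (linfty S V)"
proof (rule abelian_groupI)
  fix f assume f: "f \<in> carrier (linfty S V)"
  then show "\<exists>g\<in>carrier (linfty S V). g \<oplus>\<^bsub>linfty S V\<^esub> f = \<zero>\<^bsub>linfty S V\<^esub>"
    by (intro bexI[of _ "\<lambda>s\<in>S. \<ominus>\<^bsub>V\<^esub> f s"] linfty_minus_closed)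
      (auto simp: linfty_simps V.l_neg linfty_closed intro!: restrict_ext)
  show "\<zero>\<^bsub>linfty S V\<^esub> \<oplus>\<^bsub>linfty S V\<^esub> f = f"
    unfolding linfty_simps
    by (rule linfty_eqI[OF linfty_add_closed[OF linfty_zero_closed f] f]) (simp add: linfty_closed[OF f])
qed (auto simp: linfty_simps linfty_add_closed linfty_zero_closed linfty_closed V.a_ac
      intro!: restrict_ext)

lemma minus_linfty: "f \<in> carrier (linfty S V) \<Longrightarrow> \<ominus>\<^bsub>linfty S V\<^esub> f = (\<lambda>s\<in>S. \<ominus>\<^bsub>V\<^esub> f s)"
  by (rule abelian_group.minus_equality[OF abelian_group_linfty])
    (auto simp: linfty_simps V.l_neg linfty_closed linfty_minus_closed intro!: restrict_ext)

lemma norm_smult_linfty_le: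
  assumes f: "f \<in> carrier (linfty S V)"
  shows "vnorm (linfty S V) (c \<odot>\<^bsub>linfty S V\<^esub> f) \<le> \<bar>c\<bar> * vnorm (linfty S V) f"
  using le_norm_linfty[OF f] f
  by (intro norm_linfty_le) (simp add: linfty_simps V.norm_smult linfty_closed mult_left_mono)

lemma norm_linfty_nonneg: "f \<in> carrier (linfty S V) \<Longrightarrow> 0 \<le> vnorm (linfty S V) f"
  using S le_norm_linfty linfty_closed V.norm_nonneg by (metis all_not_in_conv order_trans)

lemma normed_vector_space_linfty: "normed_vector_space (linfty S V)"
proof (intro normed_vector_space.intro normed_group.intro abelian_group_linfty
    normed_group_axioms.intro normed_vector_space_axioms.intro)
  fix f assume f: "f \<in> carrier (linfty S V)"
  show "vnorm (linfty S V) f = 0 \<longleftrightarrow> f = \<zero>\<^bsub>linfty S V\<^esub>"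
  proof
    assume "vnorm (linfty S V) f = 0"
    then have "f s = \<zero>\<^bsub>V\<^esub>" if "s \<in> S" for s
      using le_norm_linfty[OF f that] V.norm_nonneg[OF linfty_closed[OF f that]]
        V.norm_eq_0[OF linfty_closed[OF f that]] by simp
    then show "f = \<zero>\<^bsub>linfty S V\<^esub>"
      unfolding linfty_simps using f linfty_zero_closed by (intro linfty_eqI) auto
  next
    assume "f = \<zero>\<^bsub>linfty S V\<^esub>"
    then show "vnorm (linfty S V) f = 0"
      using norm_linfty_nonneg[OF f] norm_linfty_le[of f 0] by (auto simp: linfty_simps)
  qed
  show "vnorm (linfty S V) (\<ominus>\<^bsub>linfty S V\<^esub> f) = vnorm (linfty S V) f"
  proof -
    have "(SUP s\<in>S. vnorm V ((\<lambda>s\<in>S. \<ominus>\<^bsub>V\<^esub> f s) s)) = (SUP s\<in>S. vnorm V (f s))"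
      using f by (intro SUP_cong) (auto simp: V.norm_minus linfty_closed)
    then show ?thesis unfolding minus_linfty[OF f] by (simp add: linfty_def)
  qed
  fix c :: real
  \<comment> \<open>The reverse inequality is \<open>norm_smult_linfty_le\<close> for the scalar
    \<open>1 / c\<close> applied to the multiple of \<open>f\<close> by \<open>c\<close>.\<close>
  have "\<bar>c\<bar> * vnorm (linfty S V) f \<le> vnorm (linfty S V) (c \<odot>\<^bsub>linfty S V\<^esub> f)"
  proof (cases "c = 0")
    case True
    then show ?thesis
      using norm_linfty_nonneg[OF linfty_smult_closed[OF f, of c]] by (simp add: linfty_simps)
  next
    case False
    have "f = (1 / c) \<odot>\<^bsub>linfty S V\<^esub> (c \<odot>\<^bsub>linfty S V\<^esub> f)"
      using f False unfolding linfty_simps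
      by (intro linfty_eqI linfty_smult_closed) (auto simp: V.smult_smult linfty_closed)
    then have "vnorm (linfty S V) f \<le> \<bar>1 / c\<bar> * vnorm (linfty S V) (c \<odot>\<^bsub>linfty S V\<^esub> f)"
      using norm_smult_linfty_le[OF linfty_smult_closed[OF f], of "1 / c" c]
      by (metis linfty_simps(3))
    then show ?thesis using False by (simp add: field_simps)
  qed
  then show "vnorm (linfty S V) (c \<odot>\<^bsub>linfty S V\<^esub> f) = \<bar>c\<bar> * vnorm (linfty S V) f"
    using norm_smult_linfty_le[OF f, of c] by simp
next
  fix f g assume f: "f \<in> carrier (linfty S V)" and g: "g \<in> carrier (linfty S V)"
  show "vnorm (linfty S V) (f \<oplus>\<^bsub>linfty S V\<^esub> g) \<le> vnorm (linfty S V) f + vnorm (linfty S V) g"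
  proof (rule norm_linfty_le)
    fix s assume s: "s \<in> S"
    show "vnorm V ((f \<oplus>\<^bsub>linfty S V\<^esub> g) s) \<le> vnorm (linfty S V) f + vnorm (linfty S V) g"
      using s V.norm_triangle[of "f s" "g s"] le_norm_linfty[OF f s] le_norm_linfty[OF g s]
        linfty_closed[OF f s] linfty_closed[OF g s] by (simp add: linfty_simps)
  qed
next
  fix f assume f: "f \<in> carrier (linfty S V)"
  show "1 \<odot>\<^bsub>linfty S V\<^esub> f = f"
    unfolding linfty_simps using f by (intro linfty_eqI linfty_smult_closed) (auto simp: linfty_closed)
qed (auto simp: linfty_simps linfty_smult_closed linfty_closed V.smult_add_left V.smult_add_right
      V.smult_smult intro!: restrict_ext)

end

text \<open>
  Condition \<open>anti\<close> is what the simplicial identities give for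
  \<open>h i j = (-1)\<^bsup>i+j\<^esup> \<partial>\<^sub>i \<partial>\<^sub>j\<close>.
\<close>

lemma (in abelian_group) alternating_double_sum:
  assumes h: "\<And>i j. \<lbrakk>i \<le> Suc n; j \<le> n\<rbrakk> \<Longrightarrow> h i j \<in> carrier G"
    and anti: "\<And>i j. \<lbrakk>i \<le> j; j \<le> n\<rbrakk> \<Longrightarrow> h (Suc j) i = \<ominus> h i j"
  shows "(\<Oplus>i\<in>{..Suc n}. \<Oplus>j\<in>{..n}. h i j) = \<zero>"
  using assms
proof (induction n)
  case 0
  have "h 0 0 \<in> carrier G" "h (Suc 0) 0 = \<ominus> h 0 0" using 0 by auto
  then show ?case by (simp add: finsum_Suc Pi_def atMost_Suc[of 0] l_neg)
next
  case (Suc n)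
  have car: "h i j \<in> carrier G" if "i \<le> Suc (Suc n)" "j \<le> Suc n" for i j
    using Suc.prems(1) that by blast
  have "(\<Oplus>i\<in>{..Suc n}. \<Oplus>j\<in>{..Suc n}. h i j)
      = (\<Oplus>i\<in>{..Suc n}. h i (Suc n) \<oplus> (\<Oplus>j\<in>{..n}. h i j))"
    by (intro finsum_cong') (auto simp: finsum_Suc Pi_def car)
  also have "\<dots> = (\<Oplus>i\<in>{..Suc n}. h i (Suc n)) \<oplus> (\<Oplus>i\<in>{..Suc n}. \<Oplus>j\<in>{..n}. h i j)"
    by (rule finsum_addf) (auto simp: Pi_def car)
  also have "(\<Oplus>i\<in>{..Suc n}. \<Oplus>j\<in>{..n}. h i j) = \<zero>"
    using Suc.prems by (intro Suc.IH) auto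
  finally have 1: "(\<Oplus>i\<in>{..Suc n}. \<Oplus>j\<in>{..Suc n}. h i j) = (\<Oplus>i\<in>{..Suc n}. h i (Suc n))"
    by (simp add: Pi_def car)
  \<comment> \<open>Enlarging \<open>n\<close> adds a last column and a last row. They cancel entry
    by entry, which is \<open>anti\<close> for \<open>j = Suc n\<close>.\<close>
  have "(\<Oplus>j\<in>{..Suc n}. h (Suc (Suc n)) j) \<oplus> (\<Oplus>i\<in>{..Suc n}. h i (Suc n))
      = (\<Oplus>i\<in>{..Suc n}. h (Suc (Suc n)) i \<oplus> h i (Suc n))"
    by (rule finsum_addf[symmetric]) (auto simp: Pi_def car)
  also have "\<dots> = (\<Oplus>i\<in>{..Suc n}. \<zero>)"
    using Suc.prems(2) by (intro finsum_cong') (auto simp: car l_neg)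
  finally have "(\<Oplus>j\<in>{..Suc n}. h (Suc (Suc n)) j) \<oplus> (\<Oplus>i\<in>{..Suc n}. h i (Suc n)) = \<zero>"
    by simp
  then show ?case
    unfolding 1[symmetric] by (subst finsum_Suc) (auto simp: Pi_def car intro!: finsum_closed)
qed

section \<open>Merging entries of tuples and the face maps\<close>

lemma length_merge_at [simp]: "\<lbrakk>1 \<le> i; i < length \<gamma>\<rbrakk> \<Longrightarrow> length (merge_at \<Gamma> i \<gamma>) = length \<gamma> - 1"
  by (simp add: merge_at_def)

lemma nth_merge_at:
  "\<lbrakk>1 \<le> i; i < length \<gamma>; m < length \<gamma> - 1\<rbrakk> \<Longrightarrow>
    merge_at \<Gamma> i \<gamma> ! m =
      (if m < i - 1 then \<gamma> ! m else if m = i - 1 then \<gamma> ! m \<otimes>\<^bsub>\<Gamma>\<^esub> \<gamma> ! Suc m else \<gamma> ! Suc m)"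
  by (auto simp: merge_at_def nth_append min_def nth_Cons' )

text \<open>Merging at \<open>i\<close> shifts all later positions down by one, so
  \<open>Suc j\<close> becomes \<open>j\<close>. For \<open>i < j\<close> the two merges do not
  interact; for \<open>i = j\<close> they form one product of three entries, and associativity is
  used.\<close>

lemma merge_at_merge_at:
  assumes "Group.group \<Gamma>" "set \<gamma> \<subseteq> carrier \<Gamma>" "1 \<le> i" "i \<le> j" "Suc j < length \<gamma>"
  shows "merge_at \<Gamma> i (merge_at \<Gamma> (Suc j) \<gamma>) = merge_at \<Gamma> j (merge_at \<Gamma> i \<gamma>)"
proof (rule nth_equalityI)
  interpret Group.group \<Gamma> by fact
  fix m assume "m < length (merge_at \<Gamma> i (merge_at \<Gamma> (Suc j) \<gamma>))"
  then have m: "m < length \<gamma> - 2" using assms by simp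
  have car: "\<gamma> ! k \<in> carrier \<Gamma>" if "k < length \<gamma>" for k
    using that assms(2) by (meson nth_mem subsetD)
  show "merge_at \<Gamma> i (merge_at \<Gamma> (Suc j) \<gamma>) ! m = merge_at \<Gamma> j (merge_at \<Gamma> i \<gamma>) ! m"
  proof -
    \<comment> \<open>Predecessors match the positions counted from 0; the entry
      \<open>m = i' = j'\<close> is the one with a triple product.\<close>
    obtain i' j' where ij: "i = Suc i'" "j = Suc j'" "i' \<le> j'"
      using assms(3,4) by (metis Suc_le_D Suc_le_mono One_nat_def)
    have l: "length \<gamma> = Suc (Suc (length \<gamma> - 2))" "j' < length \<gamma> - 2" "i' < length \<gamma> - 2"
      using assms(5) ij by auto
    consider "m < i'" "m < j'" | "m = i'" "i' = j'" | "m = i'" "i' < j'" | "i' < m" "m < j'"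
      | "i' < m" "m = j'" | "i' < m" "j' < m" using ij(3) by linarith
    then show ?thesis
      using m ij(3) l by cases (simp_all add: ij(1,2) nth_merge_at car m_assoc)
  qed
qed (use assms in simp)

lemma merge_at_Cons: "1 \<le> i \<Longrightarrow> merge_at \<Gamma> (Suc i) (a # \<gamma>) = a # merge_at \<Gamma> i \<gamma>"
  by (cases i) (auto simp: merge_at_def)

lemma butlast_merge_at:
  "\<lbrakk>1 \<le> i; Suc i < length \<gamma>\<rbrakk> \<Longrightarrow> butlast (merge_at \<Gamma> i \<gamma>) = merge_at \<Gamma> i (butlast \<gamma>)"
  by (rule nth_equalityI) (auto simp: nth_butlast nth_merge_at)

lemma butlast_merge_at_last:
  "\<lbrakk>1 \<le> i; Suc i = length \<gamma>\<rbrakk> \<Longrightarrow> butlast (merge_at \<Gamma> i \<gamma>) = butlast (butlast \<gamma>)"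
  by (rule nth_equalityI) (auto simp: nth_butlast nth_merge_at)

lemma merge_at_tuples:
  assumes "Group.group \<Gamma>" "\<gamma> \<in> tuples \<Gamma> (Suc n)" "1 \<le> i" "i \<le> n"
  shows "merge_at \<Gamma> i \<gamma> \<in> tuples \<Gamma> n"
proof -
  interpret Group.group \<Gamma> by fact
  have car: "\<gamma> ! k \<in> carrier \<Gamma>" if "k < length \<gamma>" for k
    using that assms(2) by (auto simp: tuples_def)
  show ?thesis
    using assms car by (auto simp: tuples_def in_set_conv_nth nth_merge_at)
qed

text \<open>The coface maps of the inhomogeneous bar complex. One index for the three kinds of terms
  in \<open>codiff\<close> makes the square of the codifferential a double sum governed by
  simplicial identities; the last branch is meant for \<open>i = n\<close>.\<close>

definition face ::
  "('g, 'm) monoid_scheme \<Rightarrow> ('g \<Rightarrow> 'e \<Rightarrow> 'e) \<Rightarrow> nat \<Rightarrow> nat \<Rightarrow> ('g list \<Rightarrow> 'e) \<Rightarrow> 'g list \<Rightarrow> 'e" where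
  "face \<Gamma> \<rho> n i f \<gamma> =
     (if i = 0 then \<rho> (hd \<gamma>) (f (tl \<gamma>)) else if i < n then f (merge_at \<Gamma> i \<gamma>) else f (butlast \<gamma>))"

section \<open>The bar complex of an isometric action\<close>

locale isometric_action = V: normed_vector_space V + G: Group.group \<Gamma>
  for V :: "'e normed_module" and \<Gamma> :: "('g, 'm) monoid_scheme" +
  fixes \<rho> :: "'g \<Rightarrow> 'e \<Rightarrow> 'e"
  assumes action: "\<rho> \<in> hom \<Gamma> (Isom V)"
begin

abbreviation "L n \<equiv> linfty (tuples \<Gamma> n) V"

lemma action_isometry: "g \<in> carrier \<Gamma> \<Longrightarrow> \<rho> g \<in> linear_isometries V"
  using action by (auto simp: hom_def Isom_def)

lemma action_closed [simp]: "\<lbrakk>g \<in> carrier \<Gamma>; x \<in> carrier V\<rbrakk> \<Longrightarrow> \<rho> g x \<in> carrier V"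
  using action_isometry by (fastforce simp: linear_isometries_def Bij_def bij_betw_def)

lemma action_add: "\<lbrakk>g \<in> carrier \<Gamma>; x \<in> carrier V; y \<in> carrier V\<rbrakk> \<Longrightarrow> \<rho> g (x \<oplus>\<^bsub>V\<^esub> y) = \<rho> g x \<oplus>\<^bsub>V\<^esub> \<rho> g y"
  using action_isometry by (auto simp: linear_isometries_def)

lemma action_smult: "\<lbrakk>g \<in> carrier \<Gamma>; x \<in> carrier V\<rbrakk> \<Longrightarrow> \<rho> g (c \<odot>\<^bsub>V\<^esub> x) = c \<odot>\<^bsub>V\<^esub> \<rho> g x"
  using action_isometry by (auto simp: linear_isometries_def)

lemma action_norm: "\<lbrakk>g \<in> carrier \<Gamma>; x \<in> carrier V\<rbrakk> \<Longrightarrow> vnorm V (\<rho> g x) = vnorm V x"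
  using action_isometry by (auto simp: linear_isometries_def)

lemma action_mult:
  assumes "g \<in> carrier \<Gamma>" "h \<in> carrier \<Gamma>" "x \<in> carrier V"
  shows "\<rho> (g \<otimes>\<^bsub>\<Gamma>\<^esub> h) x = \<rho> g (\<rho> h x)"
proof -
  have "\<rho> (g \<otimes>\<^bsub>\<Gamma>\<^esub> h) = \<rho> g \<otimes>\<^bsub>Isom V\<^esub> \<rho> h"
    using action assms by (simp add: hom_def)
  also have "\<dots> = compose (carrier V) (\<rho> g) (\<rho> h)"
    using action_isometry[OF assms(1)] action_isometry[OF assms(2)]
    by (simp add: Isom_def BijGroup_def linear_isometries_def)
  finally show ?thesis using assms by (simp add: compose_eq)
qed

lemma action_finsum:
  assumes "g \<in> carrier \<Gamma>" "finite I" "\<And>i. i \<in> I \<Longrightarrow> F i \<in> carrier V"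
  shows "\<rho> g (\<Oplus>\<^bsub>V\<^esub>i\<in>I. F i) = (\<Oplus>\<^bsub>V\<^esub>i\<in>I. \<rho> g (F i))"
  using assms(2,3)
proof (induction I rule: finite_induct)
  case empty
  show ?case using action_smult[OF assms(1), of "\<zero>\<^bsub>V\<^esub>" 0] assms(1) by simp
next
  case (insert i I)
  then show ?case using assms(1) by (simp add: V.finsum_insert Pi_def action_add)
qed

lemma tuples_nonempty: "tuples \<Gamma> n \<noteq> {}"
proof -
  have "replicate n \<one>\<^bsub>\<Gamma>\<^esub> \<in> tuples \<Gamma> n" by (auto simp: tuples_def)
  then show ?thesis by blast
qed

lemma tl_tuples: "\<gamma> \<in> tuples \<Gamma> (Suc n) \<Longrightarrow> tl \<gamma> \<in> tuples \<Gamma> n"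
  by (cases \<gamma>) (auto simp: tuples_def)

lemma hd_tuples: "\<gamma> \<in> tuples \<Gamma> (Suc n) \<Longrightarrow> hd \<gamma> \<in> carrier \<Gamma>"
  by (cases \<gamma>) (auto simp: tuples_def)

lemma butlast_tuples: "\<gamma> \<in> tuples \<Gamma> (Suc n) \<Longrightarrow> butlast \<gamma> \<in> tuples \<Gamma> n"
  by (auto simp: tuples_def dest: in_set_butlastD)

lemmas face_tuples = tl_tuples hd_tuples butlast_tuples merge_at_tuples[OF G.group_axioms]

lemma face_closed:
  "\<lbrakk>f \<in> tuples \<Gamma> n \<rightarrow> carrier V; \<gamma> \<in> tuples \<Gamma> (Suc n)\<rbrakk> \<Longrightarrow> face \<Gamma> \<rho> (Suc n) i f \<gamma> \<in> carrier V"
  by (auto simp: face_def Pi_def face_tuples)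

lemma face_norm_le:
  assumes "f \<in> tuples \<Gamma> n \<rightarrow> carrier V" "\<And>\<gamma>. \<gamma> \<in> tuples \<Gamma> n \<Longrightarrow> vnorm V (f \<gamma>) \<le> R"
    and "\<gamma> \<in> tuples \<Gamma> (Suc n)"
  shows "vnorm V (face \<Gamma> \<rho> (Suc n) i f \<gamma>) \<le> R"
  using assms by (auto simp: face_def Pi_def face_tuples action_norm)

lemma codiff_eq:
  assumes f: "f \<in> tuples \<Gamma> n \<rightarrow> carrier V" and \<gamma>: "\<gamma> \<in> tuples \<Gamma> (Suc n)"
  shows "codiff \<Gamma> V \<rho> (Suc n) f \<gamma> = (\<Oplus>\<^bsub>V\<^esub>i\<in>{..Suc n}. (-1) ^ i \<odot>\<^bsub>V\<^esub> face \<Gamma> \<rho> (Suc n) i f \<gamma>)"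
proof -
  let ?F = "\<lambda>i. (-1) ^ i \<odot>\<^bsub>V\<^esub> face \<Gamma> \<rho> (Suc n) i f \<gamma>"
  have car: "?F i \<in> carrier V" for i
    using face_closed[OF f \<gamma>] by simp
  have "{..Suc n} = insert (Suc n) (insert 0 {1..n})" by auto
  then have "(\<Oplus>\<^bsub>V\<^esub>i\<in>{..Suc n}. ?F i) = ?F (Suc n) \<oplus>\<^bsub>V\<^esub> (?F 0 \<oplus>\<^bsub>V\<^esub> (\<Oplus>\<^bsub>V\<^esub>i\<in>{1..n}. ?F i))"
    using face_closed[OF f \<gamma>] by (simp only:) (simp add: V.finsum_insert Pi_def del: power_Suc)
  also have "(\<Oplus>\<^bsub>V\<^esub>i\<in>{1..n}. ?F i) = (\<Oplus>\<^bsub>V\<^esub>i\<in>{1..n}. (-1) ^ i \<odot>\<^bsub>V\<^esub> f (merge_at \<Gamma> i \<gamma>))"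
    using f \<gamma> by (intro V.finsum_cong') (auto simp: face_def Pi_def face_tuples)
  also have "?F 0 = \<rho> (hd \<gamma>) (f (tl \<gamma>))"
    using car[of 0] f \<gamma> by (simp add: face_def Pi_def face_tuples)
  also have "?F (Suc n) = (-1) ^ Suc n \<odot>\<^bsub>V\<^esub> f (butlast \<gamma>)"
    by (simp add: face_def)
  finally have "(\<Oplus>\<^bsub>V\<^esub>i\<in>{..Suc n}. ?F i) = (-1) ^ Suc n \<odot>\<^bsub>V\<^esub> f (butlast \<gamma>) \<oplus>\<^bsub>V\<^esub>
    (\<rho> (hd \<gamma>) (f (tl \<gamma>)) \<oplus>\<^bsub>V\<^esub> (\<Oplus>\<^bsub>V\<^esub>i\<in>{1..n}. (-1) ^ i \<odot>\<^bsub>V\<^esub> f (merge_at \<Gamma> i \<gamma>)))" .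
  moreover have "(\<Oplus>\<^bsub>V\<^esub>i\<in>{1..n}. (-1) ^ i \<odot>\<^bsub>V\<^esub> f (merge_at \<Gamma> i \<gamma>)) \<in> carrier V"
    using f \<gamma> by (intro V.finsum_closed) (auto simp: Pi_def face_tuples)
  ultimately show ?thesis
    using f \<gamma> by (simp add: codiff_def Pi_def face_tuples V.a_comm del: power_Suc)
qed

lemma norm_finsum_le:
  assumes "finite I" "\<And>i. i \<in> I \<Longrightarrow> F i \<in> carrier V \<and> vnorm V (F i) \<le> R"
  shows "vnorm V (\<Oplus>\<^bsub>V\<^esub>i\<in>I. F i) \<le> real (card I) * R"
  using assms
proof (induction I rule: finite_induct)
  case (insert i I)
  have "vnorm V (F i \<oplus>\<^bsub>V\<^esub> (\<Oplus>\<^bsub>V\<^esub>i\<in>I. F i)) \<le> vnorm V (F i) + vnorm V (\<Oplus>\<^bsub>V\<^esub>i\<in>I. F i)"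
    using insert by (intro V.norm_triangle) (auto intro!: V.finsum_closed)
  moreover have "vnorm V (F i) \<le> R" "vnorm V (\<Oplus>\<^bsub>V\<^esub>i\<in>I. F i) \<le> real (card I) * R"
    using insert by auto
  ultimately have "vnorm V (F i \<oplus>\<^bsub>V\<^esub> (\<Oplus>\<^bsub>V\<^esub>i\<in>I. F i)) \<le> R + real (card I) * R" by linarith
  then show ?case using insert by (simp add: V.finsum_insert Pi_def algebra_simps)
qed simp

lemma codiff_closed:
  assumes f: "f \<in> tuples \<Gamma> n \<rightarrow> carrier V" and \<gamma>: "\<gamma> \<in> tuples \<Gamma> (Suc n)"
  shows "codiff \<Gamma> V \<rho> (Suc n) f \<gamma> \<in> carrier V"
  unfolding codiff_eq[OF f \<gamma>] using face_closed[OF f \<gamma>] by (intro V.finsum_closed) auto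

text \<open>\<open>n + 2\<close> counts the faces, and each face preserves the bound
  \<open>R\<close> because the action is isometric.\<close>

lemma codiff_norm_le:
  assumes f: "f \<in> tuples \<Gamma> n \<rightarrow> carrier V" and \<gamma>: "\<gamma> \<in> tuples \<Gamma> (Suc n)"
    and R: "\<And>\<gamma>. \<gamma> \<in> tuples \<Gamma> n \<Longrightarrow> vnorm V (f \<gamma>) \<le> R"
  shows "vnorm V (codiff \<Gamma> V \<rho> (Suc n) f \<gamma>) \<le> real (n + 2) * R"
proof -
  have "vnorm V (\<Oplus>\<^bsub>V\<^esub>i\<in>{..Suc n}. (-1) ^ i \<odot>\<^bsub>V\<^esub> face \<Gamma> \<rho> (Suc n) i f \<gamma>)
      \<le> real (card {..Suc n}) * R"
    using face_closed[OF f \<gamma>] face_norm_le[OF f R \<gamma>]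
    by (intro norm_finsum_le) (auto simp: V.norm_smult power_abs)
  then show ?thesis unfolding codiff_eq[OF f \<gamma>] by simp
qed

lemma L_Pi: "f \<in> carrier (L n) \<Longrightarrow> f \<in> tuples \<Gamma> n \<rightarrow> carrier V"
  by (auto simp: linfty_def)

text \<open>Elements of \<open>linfty\<close> are extensional functions; exposing the restriction
  reduces membership and equality to values on tuples.\<close>

lemma codiff_extensional: "codiff \<Gamma> V \<rho> n f = (\<lambda>\<gamma>\<in>tuples \<Gamma> n. codiff \<Gamma> V \<rho> n f \<gamma>)"
  by (auto simp: codiff_def)

lemma codiff_L:
  assumes "f \<in> carrier (L n)"
  shows "codiff \<Gamma> V \<rho> (Suc n) f \<in> carrier (L (Suc n))"
  using le_norm_linfty[OF V.normed_vector_space_axioms tuples_nonempty assms] L_Pi[OF assms]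
  by (subst codiff_extensional, intro linfty_carrierI[OF V.normed_vector_space_axioms tuples_nonempty,
        where R = "real (n + 2) * vnorm (L n) f"] codiff_closed codiff_norm_le)

lemma face_add:
  assumes "f \<in> tuples \<Gamma> n \<rightarrow> carrier V" "g \<in> tuples \<Gamma> n \<rightarrow> carrier V" "\<gamma> \<in> tuples \<Gamma> (Suc n)"
  shows "face \<Gamma> \<rho> (Suc n) i (\<lambda>\<gamma>\<in>tuples \<Gamma> n. f \<gamma> \<oplus>\<^bsub>V\<^esub> g \<gamma>) \<gamma>
    = face \<Gamma> \<rho> (Suc n) i f \<gamma> \<oplus>\<^bsub>V\<^esub> face \<Gamma> \<rho> (Suc n) i g \<gamma>"
  using assms by (auto simp: face_def Pi_def face_tuples action_add)

lemma face_smult: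
  assumes "f \<in> tuples \<Gamma> n \<rightarrow> carrier V" "\<gamma> \<in> tuples \<Gamma> (Suc n)"
  shows "face \<Gamma> \<rho> (Suc n) i (\<lambda>\<gamma>\<in>tuples \<Gamma> n. c \<odot>\<^bsub>V\<^esub> f \<gamma>) \<gamma> = c \<odot>\<^bsub>V\<^esub> face \<Gamma> \<rho> (Suc n) i f \<gamma>"
  using assms by (auto simp: face_def Pi_def face_tuples action_smult)

lemma smult_finsum:
  assumes "finite I" "\<And>i. i \<in> I \<Longrightarrow> F i \<in> carrier V"
  shows "c \<odot>\<^bsub>V\<^esub> (\<Oplus>\<^bsub>V\<^esub>i\<in>I. F i) = (\<Oplus>\<^bsub>V\<^esub>i\<in>I. c \<odot>\<^bsub>V\<^esub> F i)"
  using assms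
proof (induction I rule: finite_induct)
  case empty
  show ?case using V.smult_smult[of "\<zero>\<^bsub>V\<^esub>" c 0] by simp
next
  case (insert i I)
  then show ?case by (simp add: V.finsum_insert Pi_def V.smult_add_right)
qed

lemma codiff_bounded_operator:
  "bounded_operator (L n) (L (Suc n)) (real (n + 2)) (codiff \<Gamma> V \<rho> (Suc n))"
  unfolding bounded_operator_def
proof (intro conjI ballI allI)
  show "codiff \<Gamma> V \<rho> (Suc n) \<in> carrier (L n) \<rightarrow> carrier (L (Suc n))"
    using codiff_L by blast
next
  fix f g assume f: "f \<in> carrier (L n)" and g: "g \<in> carrier (L n)"
  note fg = L_Pi[OF f] L_Pi[OF g]
  have "codiff \<Gamma> V \<rho> (Suc n) (f \<oplus>\<^bsub>L n\<^esub> g) \<gamma>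
      = codiff \<Gamma> V \<rho> (Suc n) f \<gamma> \<oplus>\<^bsub>V\<^esub> codiff \<Gamma> V \<rho> (Suc n) g \<gamma>" if \<gamma>: "\<gamma> \<in> tuples \<Gamma> (Suc n)" for \<gamma>
  proof -
    have sum: "(\<lambda>\<gamma>\<in>tuples \<Gamma> n. f \<gamma> \<oplus>\<^bsub>V\<^esub> g \<gamma>) \<in> tuples \<Gamma> n \<rightarrow> carrier V" using fg by auto
    have "codiff \<Gamma> V \<rho> (Suc n) (f \<oplus>\<^bsub>L n\<^esub> g) \<gamma> = (\<Oplus>\<^bsub>V\<^esub>i\<in>{..Suc n}.
        (-1) ^ i \<odot>\<^bsub>V\<^esub> face \<Gamma> \<rho> (Suc n) i f \<gamma> \<oplus>\<^bsub>V\<^esub> (-1) ^ i \<odot>\<^bsub>V\<^esub> face \<Gamma> \<rho> (Suc n) i g \<gamma>)"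
      using face_closed[OF fg(1) \<gamma>] face_closed[OF fg(2) \<gamma>]
      by (simp add: linfty_def codiff_eq[OF sum \<gamma>] face_add[OF fg \<gamma>] V.smult_add_right
          del: power_Suc V.finsum_Suc)
    also have "\<dots> = codiff \<Gamma> V \<rho> (Suc n) f \<gamma> \<oplus>\<^bsub>V\<^esub> codiff \<Gamma> V \<rho> (Suc n) g \<gamma>"
      unfolding codiff_eq[OF fg(1) \<gamma>] codiff_eq[OF fg(2) \<gamma>]
      using face_closed[OF fg(1) \<gamma>] face_closed[OF fg(2) \<gamma>] by (intro V.finsum_addf) auto
    finally show ?thesis .
  qed
  then show "codiff \<Gamma> V \<rho> (Suc n) (f \<oplus>\<^bsub>L n\<^esub> g)
      = codiff \<Gamma> V \<rho> (Suc n) f \<oplus>\<^bsub>L (Suc n)\<^esub> codiff \<Gamma> V \<rho> (Suc n) g"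
    by (subst codiff_extensional) (auto simp: linfty_def intro!: restrict_ext)
next
  fix c f assume f: "f \<in> carrier (L n)"
  note fp = L_Pi[OF f]
  have "codiff \<Gamma> V \<rho> (Suc n) (c \<odot>\<^bsub>L n\<^esub> f) \<gamma> = c \<odot>\<^bsub>V\<^esub> codiff \<Gamma> V \<rho> (Suc n) f \<gamma>"
    if \<gamma>: "\<gamma> \<in> tuples \<Gamma> (Suc n)" for \<gamma>
  proof -
    have "(\<lambda>\<gamma>\<in>tuples \<Gamma> n. c \<odot>\<^bsub>V\<^esub> f \<gamma>) \<in> tuples \<Gamma> n \<rightarrow> carrier V" using fp by (auto simp: Pi_def)
    then show ?thesis
      using face_closed[OF fp \<gamma>]
      by (simp add: linfty_def codiff_eq fp \<gamma> face_smult smult_finsum V.smult_smult mult.commute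
          del: power_Suc V.finsum_Suc)
  qed
  then show "codiff \<Gamma> V \<rho> (Suc n) (c \<odot>\<^bsub>L n\<^esub> f) = c \<odot>\<^bsub>L (Suc n)\<^esub> codiff \<Gamma> V \<rho> (Suc n) f"
    by (subst codiff_extensional) (auto simp: linfty_def intro!: restrict_ext)
next
  fix f assume f: "f \<in> carrier (L n)"
  show "vnorm (L (Suc n)) (codiff \<Gamma> V \<rho> (Suc n) f) \<le> real (n + 2) * vnorm (L n) f"
    using le_norm_linfty[OF V.normed_vector_space_axioms tuples_nonempty f] L_Pi[OF f]
    by (intro norm_linfty_le[OF V.normed_vector_space_axioms tuples_nonempty] codiff_norm_le)
qed

text \<open>The cosimplicial identities. Algebra enters only on the diagonal \<open>i = j\<close>:
  the action law for \<open>i = 0\<close>, and associativity for \<open>1 \<le> i \<le> n\<close>.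
  In the other cases list operations are moved past each other, or, for
  \<open>i = j = Suc n\<close>, both sides drop the last two entries.\<close>

lemma face_face:
  assumes f: "f \<in> tuples \<Gamma> n \<rightarrow> carrier V" and \<gamma>: "\<gamma> \<in> tuples \<Gamma> (Suc (Suc n))"
    and ij: "i \<le> j" "j \<le> Suc n"
  shows "face \<Gamma> \<rho> (Suc (Suc n)) (Suc j) (face \<Gamma> \<rho> (Suc n) i f) \<gamma>
    = face \<Gamma> \<rho> (Suc (Suc n)) i (face \<Gamma> \<rho> (Suc n) j f) \<gamma>"
proof -
  have len: "length \<gamma> = Suc (Suc n)" and set: "set \<gamma> \<subseteq> carrier \<Gamma>"
    using \<gamma> by (auto simp: tuples_def)
  then obtain a b r where abr: "\<gamma> = a # b # r" by (metis length_Suc_conv)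
  show ?thesis
  proof (cases "i = 0")
    case i: True
    consider "j = 0" | "1 \<le> j" "j < Suc n" | "j = Suc n" "j > 0" using ij by linarith
    then show ?thesis
    proof cases
      case 1
      have "r \<in> tuples \<Gamma> n" using len set abr by (auto simp: tuples_def)
      then show ?thesis
        using i 1 set f by (auto simp: face_def abr merge_at_def action_mult Pi_def)
    next
      case 2
      then show ?thesis using i by (simp add: face_def abr merge_at_Cons)
    next
      case 3
      then show ?thesis using i by (simp add: face_def abr)
    qed
  next
    case i: False
    consider "j < Suc n" | "i < Suc n" "j = Suc n" | "i = Suc n" "j = Suc n" using ij by linarith
    then show ?thesis
    proof cases
      case 1
      then show ?thesis
        using i ij merge_at_merge_at[OF G.group_axioms set, of i j] len by (simp add: face_def)
    next
      case 2
      then show ?thesis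
        using i len by (simp add: face_def butlast_merge_at)
    next
      case 3
      then show ?thesis
        using i len by (simp add: face_def butlast_merge_at_last)
    qed
  qed
qed

lemma codiff_codiff:
  assumes f: "f \<in> carrier (L n)"
  shows "codiff \<Gamma> V \<rho> (Suc (Suc n)) (codiff \<Gamma> V \<rho> (Suc n) f) = \<zero>\<^bsub>L (Suc (Suc n))\<^esub>"
proof -
  note fp = L_Pi[OF f]
  have "codiff \<Gamma> V \<rho> (Suc (Suc n)) (codiff \<Gamma> V \<rho> (Suc n) f) \<gamma> = \<zero>\<^bsub>V\<^esub>"
    if \<gamma>: "\<gamma> \<in> tuples \<Gamma> (Suc (Suc n))" for \<gamma>
  proof -
    define h where "h i j = (-1) ^ (i + j) \<odot>\<^bsub>V\<^esub>
      face \<Gamma> \<rho> (Suc (Suc n)) i (face \<Gamma> \<rho> (Suc n) j f) \<gamma>" for i j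
    have ff: "face \<Gamma> \<rho> (Suc n) j f \<in> tuples \<Gamma> (Suc n) \<rightarrow> carrier V" for j
      using face_closed[OF fp] by blast
    have car: "h i j \<in> carrier V" for i j
      unfolding h_def using face_closed[OF ff \<gamma>] by simp
    have "(-1) ^ i \<odot>\<^bsub>V\<^esub> face \<Gamma> \<rho> (Suc (Suc n)) i (codiff \<Gamma> V \<rho> (Suc n) f) \<gamma>
      = (\<Oplus>\<^bsub>V\<^esub>j\<in>{..Suc n}. h i j)" for i
    proof -
      have eq: "codiff \<Gamma> V \<rho> (Suc n) f \<gamma>' = (\<Oplus>\<^bsub>V\<^esub>j\<in>{..Suc n}. (-1) ^ j \<odot>\<^bsub>V\<^esub> face \<Gamma> \<rho> (Suc n) j f \<gamma>')"
        if "\<gamma>' \<in> tuples \<Gamma> (Suc n)" for \<gamma>'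
        using codiff_eq[OF fp that] .
      \<comment> \<open>An outer face evaluates its argument at one tuple and applies at most a
        linear isometry, so it passes through the inner alternating sum.\<close>
      have "face \<Gamma> \<rho> (Suc (Suc n)) i (codiff \<Gamma> V \<rho> (Suc n) f) \<gamma>
        = (\<Oplus>\<^bsub>V\<^esub>j\<in>{..Suc n}. (-1) ^ j \<odot>\<^bsub>V\<^esub> face \<Gamma> \<rho> (Suc (Suc n)) i (face \<Gamma> \<rho> (Suc n) j f) \<gamma>)"
        using \<gamma> face_closed[OF fp]
        by (auto simp: face_def[of _ _ "Suc (Suc n)"] face_tuples eq action_finsum action_smult
            intro!: V.finsum_cong' simp del: power_Suc V.finsum_Suc)
      then show ?thesis
        using face_closed[OF ff \<gamma>]
        by (simp add: smult_finsum V.smult_smult power_add h_def del: power_Suc V.finsum_Suc)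
    qed
    then have "codiff \<Gamma> V \<rho> (Suc (Suc n)) (codiff \<Gamma> V \<rho> (Suc n) f) \<gamma>
      = (\<Oplus>\<^bsub>V\<^esub>i\<in>{..Suc (Suc n)}. \<Oplus>\<^bsub>V\<^esub>j\<in>{..Suc n}. h i j)"
      using codiff_eq[OF L_Pi[OF codiff_L[OF f]] \<gamma>] by (simp del: power_Suc V.finsum_Suc)
    also have "\<dots> = \<zero>\<^bsub>V\<^esub>"
    proof (rule V.alternating_double_sum)
      fix i j assume "i \<le> j" "j \<le> Suc n"
      then have "face \<Gamma> \<rho> (Suc (Suc n)) (Suc j) (face \<Gamma> \<rho> (Suc n) i f) \<gamma>
        = face \<Gamma> \<rho> (Suc (Suc n)) i (face \<Gamma> \<rho> (Suc n) j f) \<gamma>"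
        by (rule face_face[OF fp \<gamma>])
      \<comment> \<open>The faces agree, while the exponent of the sign rises by one.\<close>
      then show "h (Suc j) i = \<ominus>\<^bsub>V\<^esub> h i j"
        using face_closed[OF ff \<gamma>] by (simp add: h_def V.smult_uminus add.commute)
    qed (rule car)
    finally show ?thesis .
  qed
  then show ?thesis
    by (subst codiff_extensional) (auto simp: linfty_def intro!: restrict_ext)
qed

end

section \<open>Asymptotic cohomology as an instance\<close>

lemma asymptotic_ultraproduct_complex:
  assumes U: "nonprincipal_ultrafilter \<U>" and G: "Group.group \<Gamma>"
    and E: "asymptotic_banach_module \<Gamma> E \<pi>"
  shows "ultraproduct_complex \<U> (\<lambda>k. linfty (tuples \<Gamma> n) (E k))
    (\<lambda>k. linfty (tuples \<Gamma> (Suc n)) (E k)) (\<lambda>k. linfty (tuples \<Gamma> (Suc (Suc n))) (E k))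
    (\<lambda>k. codiff \<Gamma> (E k) (\<pi> k) (Suc n)) (real (n + 2))
    (\<lambda>k. codiff \<Gamma> (E k) (\<pi> k) (Suc (Suc n))) (real (Suc n + 2))"
proof -
  have act: "isometric_action (E k) \<Gamma> (\<pi> k)" for k
    using E G normed_space_imp_normed_vector_space[of "E k"]
    by (simp add: isometric_action_def isometric_action_axioms_def asymptotic_banach_module_def
        banach_space_def)
  have vs: "normed_vector_space (linfty (tuples \<Gamma> m) (E k))" for m k
  proof -
    interpret isometric_action "E k" \<Gamma> "\<pi> k" by (rule act)
    show ?thesis by (rule normed_vector_space_linfty[OF V.normed_vector_space_axioms tuples_nonempty])
  qed
  have seq: "normed_group_sequence \<U> (\<lambda>k. linfty (tuples \<Gamma> m) (E k))" for m
    using U vs by (simp add: normed_group_sequence_def normed_vector_space_def)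
  \<comment> \<open>The bound \<open>m + 2\<close> is the same for all \<open>k\<close>, so the
    codifferentials induce maps of ultraproducts.\<close>
  have op: "ultraproduct_operator \<U> (\<lambda>k. linfty (tuples \<Gamma> m) (E k))
      (\<lambda>k. linfty (tuples \<Gamma> (Suc m)) (E k)) (\<lambda>k. codiff \<Gamma> (E k) (\<pi> k) (Suc m)) (real (m + 2))" for m
    using seq isometric_action.codiff_bounded_operator[OF act]
    by (simp add: ultraproduct_operator_def ultraproduct_operator_axioms_def)
  show ?thesis
    using op[of n] op[of "Suc n"] vs isometric_action.codiff_codiff[OF act]
    by (simp add: ultraproduct_complex_def ultraproduct_complex_axioms_def)
qed

theorem theoremA:
  fixes \<U> :: "nat filter"
    and \<Gamma> :: "('g, 'm) monoid_scheme"
    and E :: "nat \<Rightarrow> 'e normed_module"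
    and \<pi> :: "nat \<Rightarrow> 'g \<Rightarrow> 'e \<Rightarrow> 'e"
    and n :: nat
  assumes "nonprincipal_ultrafilter \<U>"
    and "Group.group \<Gamma>"
    and "asymptotic_banach_module \<Gamma> E \<pi>"
    and "n \<ge> 1"
  shows "(trivial_group (reduced_asym_cohomology \<U> \<Gamma> E \<pi> n) \<longleftrightarrow>
          trivial_group (asym_cohomology \<U> \<Gamma> E \<pi> n)) \<and>
         (trivial_group (asym_cohomology \<U> \<Gamma> E \<pi> n) \<longleftrightarrow>
          trivial_group (asym_cohomology \<U> \<Gamma> E \<pi> n) \<and>
          Hausdorff_space (asym_cohomology_topology \<U> \<Gamma> E \<pi> (n + 1)))"
proof -
  \<comment> \<open>Passing to the predecessor removes the truncated subtraction
    \<open>n - 1\<close> in the coboundaries.\<close>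
  obtain p where n: "n = Suc p" using assms(4) by (metis Suc_le_D One_nat_def)
  interpret c: ultraproduct_complex \<U> "\<lambda>k. linfty (tuples \<Gamma> p) (E k)"
    "\<lambda>k. linfty (tuples \<Gamma> (Suc p)) (E k)" "\<lambda>k. linfty (tuples \<Gamma> (Suc (Suc p))) (E k)"
    "\<lambda>k. codiff \<Gamma> (E k) (\<pi> k) (Suc p)" "real (p + 2)"
    "\<lambda>k. codiff \<Gamma> (E k) (\<pi> k) (Suc (Suc p))" "real (Suc p + 2)"
    by (rule asymptotic_ultraproduct_complex[OF assms(1-3)])
  \<comment> \<open>One degree higher, this supplies that the cocycles of degree
    \<open>n + 1\<close> form a subgroup containing the coboundaries.\<close>
  interpret c': ultraproduct_complex \<U> "\<lambda>k. linfty (tuples \<Gamma> (Suc p)) (E k)"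
    "\<lambda>k. linfty (tuples \<Gamma> (Suc (Suc p))) (E k)" "\<lambda>k. linfty (tuples \<Gamma> (Suc (Suc (Suc p)))) (E k)"
    "\<lambda>k. codiff \<Gamma> (E k) (\<pi> k) (Suc (Suc p))" "real (Suc p + 2)"
    "\<lambda>k. codiff \<Gamma> (E k) (\<pi> k) (Suc (Suc (Suc p)))" "real (Suc (Suc p) + 2)"
    by (rule asymptotic_ultraproduct_complex[OF assms(1-3)])
  have cycles: "asym_cocycles \<U> \<Gamma> E \<pi> n = c.cycles" "asym_cocycles \<U> \<Gamma> E \<pi> (n + 1) = c'.cycles"
    by (simp_all add: asym_cocycles_def asym_cochains_def asym_d_def n)
  have boundaries: "asym_coboundaries \<U> \<Gamma> E \<pi> n = c.boundaries"
    "asym_coboundaries \<U> \<Gamma> E \<pi> (n + 1) = c'.boundaries"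
    by (simp_all add: asym_coboundaries_def asym_cochains_def asym_d_def n)
  have cochains: "asym_cochains \<U> \<Gamma> E n = c.d.W.UP" "asym_cochains \<U> \<Gamma> E (n + 1) = c.d'.W.UP"
    by (simp_all add: asym_cochains_def n)
  note Z = c.d'.hom.additive_subgroup_a_kernel and B = c.d.additive_subgroup_image
  have H: "trivial_group (asym_cohomology \<U> \<Gamma> E \<pi> n) \<longleftrightarrow> c.cycles \<subseteq> c.boundaries"
    unfolding asym_cohomology_def cycles boundaries cochains
    by (rule c.d.W.UP.trivial_group_A_Mod_iff[OF Z B c.boundaries_subset_cycles])
  have RH: "trivial_group (reduced_asym_cohomology \<U> \<Gamma> E \<pi> n) \<longleftrightarrow>
      c.cycles \<subseteq> norm_topology c.d.W.UP closure_of c.boundaries"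
    unfolding reduced_asym_cohomology_def cycles boundaries cochains
    by (rule c.d.W.UP.trivial_group_A_Mod_iff[OF Z c.d.W.UP.additive_subgroup_closure[OF B]
          c.closure_boundaries_subset_cycles])
  \<comment> \<open>Density is assertion (1), and the conclusion is assertion (3).\<close>
  have main: "c.cycles \<subseteq> c.boundaries \<and> Hausdorff_space (asym_cohomology_topology \<U> \<Gamma> E \<pi> (n + 1))"
    if dense: "c.cycles \<subseteq> norm_topology c.d.W.UP closure_of c.boundaries"
  proof -
    obtain K \<delta> where "0 < K" "0 < \<delta>"
      "eventually (\<lambda>k. approximately_exact (linfty (tuples \<Gamma> p) (E k)) (linfty (tuples \<Gamma> (Suc p)) (E k))
        (linfty (tuples \<Gamma> (Suc (Suc p))) (E k)) (codiff \<Gamma> (E k) (\<pi> k) (Suc p))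
        (codiff \<Gamma> (E k) (\<pi> k) (Suc (Suc p))) K \<delta>) \<U>"
      using c.eventually_approximately_exact[OF dense] by blast
    note exact = this
    have "Hausdorff_space (asym_cohomology_topology \<U> \<Gamma> E \<pi> (n + 1))"
      unfolding asym_cohomology_topology_def cycles boundaries cochains
      by (rule c.d'.W.UP.Hausdorff_space_quotient[OF c'.d'.hom.additive_subgroup_a_kernel
            c.d'.additive_subgroup_image c'.boundaries_subset_cycles
            c.closure_next_boundaries_subset[OF exact]])
    then show ?thesis using c.cycles_subset_boundaries[OF exact] by blast
  qed
  \<comment> \<open>Vanishing of the unreduced cohomology returns to density, because boundaries lie
    in their closure; this closes the circle.\<close>
  show ?thesis
    unfolding H RH using main c.boundaries_subset_closure by blast
qed

end
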